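(* Let $a\in(0,\pi/3)$ and $\nu\in\{0,1\}$. Then the two spectra of the boundary value problems ${\cal L}_{\nu,0}(a,q)$ and ${\cal L}_{\nu,1}(a,q)$ do not determine the potential $q$ uniquely. Specifically, there exists an infinite family $B$ of pairwise different complex-valued functions $q\in L_2(0,\pi)$ with $q=0$ on $(0,a)$ such that, for each $j\in\{0,1\}$, the spectrum of ${\cal L}_{\nu,j}(a,q)$ is the same for all $q\in B$.
   Context: For $\nu,j\in\{0,1\}$, $a\in(0,\pi)$ and a complex-valued $q\in L_2(0,\pi)$ with $q(x)=0$ on $(0,a)$, ${\cal L}_{\nu,j}(a,q)$ denotes the boundary value problem $$-y''(x)+q(x)y(x-a)=\lambda y(x),\quad 0<x<\pi,\qquad y^{(\nu)}(0)=y^{(j)}(\pi)=0.$$ (The values of $y$ at negative arguments are irrelevant because $q=0$ on $(0,a)$.) Its spectrum is the sequence of its eigenvalues counted with multiplicities, i.e. the zeros with multiplicities of the entire function $\Delta_{\nu,j}(\lambda)=y_{1-\nu}^{(j)}(\pi,\lambda)$ (derivative with respect to the first argument), where, for $\mu\in\{0,1\}$, $y_\mu(x,\lambda)$ is the unique solution of the differential equation $-y''(x)+q(x)y(x-a)=\lambda y(x)$, $0<x<\pi$, with initial conditions $y_\mu^{(i)}(0,\lambda)=\delta_{\mu,i}$, $i=0,1$. Functions in $L_2(0,\pi)$ are identified when equal a.e. *)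

theory Defs
  imports "HOL-Complex_Analysis.Complex_Analysis"
begin

text \<open>
  Elements of \<open>L_2(0,pi)\<close> are represented by functions on the real line; only their values on
  \<open>(0,pi)\<close> matter, and two of them are identified when \<open>ae_eq\<close> holds.
\<close>

definition in_L2 :: "(real \<Rightarrow> complex) \<Rightarrow> bool" where
  "in_L2 q \<longleftrightarrow> q \<in> borel_measurable (lebesgue_on {0<..<pi}) \<and>
     integrable (lebesgue_on {0<..<pi}) (\<lambda>x. (cmod (q x))\<^sup>2)"

definition ae_eq :: "(real \<Rightarrow> complex) \<Rightarrow> (real \<Rightarrow> complex) \<Rightarrow> bool" where
  "ae_eq p q \<longleftrightarrow> (AE x in lebesgue_on {0<..<pi}. p x = q x)"

definition is_potential :: "real \<Rightarrow> (real \<Rightarrow> complex) \<Rightarrow> bool" where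
  "is_potential a q \<longleftrightarrow> in_L2 q \<and> (AE x in lebesgue_on {0<..<a}. q x = 0)"

definition abs_continuous_on :: "real set \<Rightarrow> (real \<Rightarrow> complex) \<Rightarrow> bool" where
  "abs_continuous_on I f \<longleftrightarrow>
     (\<forall>\<epsilon>>0. \<exists>\<delta>>0. \<forall>\<D> S. \<D> division_of S \<longrightarrow> S \<subseteq> I \<longrightarrow> (\<Sum>K\<in>\<D>. measure lborel K) < \<delta> \<longrightarrow>
        (\<Sum>K\<in>\<D>. norm (f (Sup K) - f (Inf K))) < \<epsilon>)"

text \<open>The derivative of order \<open>i\<close> on \<open>[0,pi]\<close>, one-sided at the end points.\<close>

definition dd :: "nat \<Rightarrow> (real \<Rightarrow> complex) \<Rightarrow> real \<Rightarrow> complex" where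
  "dd i = (\<lambda>f x. vector_derivative f (at x within {0..pi})) ^^ i"

text \<open>
  Solutions are meant in the usual sense for an integrable coefficient: \<open>y\<close> is continuously
  differentiable on \<open>[0,pi]\<close> with \<open>y'\<close> absolutely continuous, and the equation holds almost
  everywhere. For \<open>x < a\<close> the value \<open>y (x - a)\<close> is irrelevant, as \<open>q\<close> vanishes there.
\<close>

definition is_solution :: "real \<Rightarrow> (real \<Rightarrow> complex) \<Rightarrow> complex \<Rightarrow> (real \<Rightarrow> complex) \<Rightarrow> bool" where
  "is_solution a q l y \<longleftrightarrow>
     (\<forall>x\<in>{0..pi}. y differentiable (at x within {0..pi})) \<and>
     abs_continuous_on {0..pi} (dd 1 y) \<and>
     (AE x in lebesgue_on {0<..<pi}.
        \<exists>y2. (dd 1 y has_vector_derivative y2) (at x) \<and>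
             - y2 + q x * y (x - a) = l * y x)"

text \<open>
  \<open>sol a q \<mu> x l\<close> is \<open>y\<^sub>\<mu>\<close> at \<open>x\<close> for the spectral parameter \<open>l\<close>. The solution is unique on \<open>[0,pi]\<close>; the extension by zero
  only serves to make it unique as a function on the real line.
\<close>

definition sol :: "real \<Rightarrow> (real \<Rightarrow> complex) \<Rightarrow> nat \<Rightarrow> real \<Rightarrow> complex \<Rightarrow> complex" where
  "sol a q \<mu> x l =
     (THE y. is_solution a q l y \<and>
             (\<forall>i\<in>{0,1}. dd i y 0 = (if \<mu> = i then 1 else 0)) \<and>
             (\<forall>x. x \<notin> {0..pi} \<longrightarrow> y x = 0)) x"

definition char_fun ::
  "nat \<Rightarrow> nat \<Rightarrow> real \<Rightarrow> (real \<Rightarrow> complex) \<Rightarrow> complex \<Rightarrow> complex" where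
  "char_fun \<nu> j a q l = dd j (\<lambda>x. sol a q (1 - \<nu>) x l) pi"

text \<open>
  The spectrum, a sequence of eigenvalues counted with multiplicities up to order, is encoded by
  the function assigning to each number its multiplicity as a zero of the characteristic function
  (and \<open>0\<close> to numbers that are not eigenvalues). The characteristic function is entire and not
  identically zero, so that \<open>zorder\<close> is indeed the order of the zero.
\<close>

definition spectrum :: "nat \<Rightarrow> nat \<Rightarrow> real \<Rightarrow> (real \<Rightarrow> complex) \<Rightarrow> complex \<Rightarrow> nat" where
  "spectrum \<nu> j a q l =
     (if char_fun \<nu> j a q l = 0 then nat (zorder (char_fun \<nu> j a q) l) else 0)"

end

theory Submission
  imports Defs
begin

text \<open>
  Fix \<open>0 < L < a/2\<close>. The potentials are \<open>q c = h + c e\<close>: the part \<open>h\<close> lives on \<open>[5a/2, 5a/2 + L]\<close>, while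
  \<open>e\<close> consists of a piece \<open>f\<close> on \<open>[3a/2, 3a/2 + L]\<close> and a piece \<open>- F H\<close> on \<open>[2a, 2a + L]\<close>, where \<open>F' = f\<close>,
  \<open>H' = - h\<close> up to translation. As \<open>5a/2 + L < pi\<close>, everything fits into \<open>(a, pi)\<close>. The lengths are chosen
  such that the delay couples only \<open>f\<close> with \<open>h\<close>; hence the solution is affine in \<open>c\<close>, and its slope
  solves an equation without delay whose right hand side is \<open>e(x) y(x - a) + h(x) D(x - a)\<close>, with \<open>y\<close> the
  free solution and \<open>D\<close> the response to \<open>f\<close>.

  The slope and its derivative vanish at \<open>pi\<close> iff this right hand side is orthogonal to all free
  solutions. Turning products of free solutions into sums and integrating the \<open>h\<close>-term by parts,
  the quadratic contribution splits in two: one half is cancelled by the piece \<open>- F H\<close>, the other one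
  is cancelled by the linear contribution of \<open>f\<close> if \<open>f\<close> is an eigenfunction of the Hankel-type operator
  \<open>f(x) = - s \<integral>\<^sub>x\<^sup>L H(t) f(t - x) dt\<close>, where \<open>s = 1\<close> for the Neumann and \<open>s = -1\<close> for the Dirichlet condition at 0.
  The boundary terms disappear if \<open>\<integral> f = \<integral> F H = 0\<close>. All this is achieved by
  \<open>f(x) = cos k x + cos 2 k x\<close> with \<open>k = pi / L\<close> and a multiple \<open>H\<close> of \<open>sin m (L - x)\<close> with \<open>m\<^sup>2 = 5 k\<^sup>2 / 2\<close>.
\<close>

subsection \<open>Absolute continuity\<close>

lemma abs_continuous_on_subset:
  assumes "abs_continuous_on I f" "J \<subseteq> I"
  shows "abs_continuous_on J f"
  unfolding abs_continuous_on_def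
proof (intro allI impI)
  fix e :: real assume "e > 0"
  then obtain d where "d > 0" and d: "\<And>\<D> S. \<D> division_of S \<Longrightarrow> S \<subseteq> I \<Longrightarrow>
      (\<Sum>K\<in>\<D>. measure lborel K) < d \<Longrightarrow> (\<Sum>K\<in>\<D>. norm (f (Sup K) - f (Inf K))) < e"
    using assms(1) unfolding abs_continuous_on_def by metis
  then show "\<exists>\<delta>>0. \<forall>\<D> S. \<D> division_of S \<longrightarrow> S \<subseteq> J \<longrightarrow> (\<Sum>K\<in>\<D>. measure lborel K) < \<delta> \<longrightarrow>
        (\<Sum>K\<in>\<D>. norm (f (Sup K) - f (Inf K))) < e"
    using assms(2) by (meson order_trans)
qed

lemma division_of_real_endpoints:
  assumes "\<D> division_of S" "K \<in> \<D>"
  obtains u v :: real where "K = {u..v}" "u \<le> v" "Inf K = u" "Sup K = v" "u \<in> S" "v \<in> S"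
proof -
  obtain u v where uv: "K = cbox u v" using assms by (meson division_ofD(4))
  have "K \<noteq> {}" "K \<subseteq> S" using assms by (auto dest: division_ofD)
  then have "u \<le> v" "u \<in> S" "v \<in> S" using uv by auto
  then show ?thesis using that[of u v] uv by simp
qed

lemma abs_continuous_on_diff:
  assumes f: "abs_continuous_on I f" and g: "abs_continuous_on I g"
  shows "abs_continuous_on I (\<lambda>x. f x - g x)"
  unfolding abs_continuous_on_def
proof (intro allI impI)
  fix e :: real assume "e > 0"
  then have e2: "e/2 > 0" by simp
  obtain d1 where "d1 > 0" and d1: "\<And>\<D> S. \<D> division_of S \<Longrightarrow> S \<subseteq> I \<Longrightarrow>
      (\<Sum>K\<in>\<D>. measure lborel K) < d1 \<Longrightarrow> (\<Sum>K\<in>\<D>. norm (f (Sup K) - f (Inf K))) < e/2"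
    using f e2 unfolding abs_continuous_on_def by metis
  obtain d2 where "d2 > 0" and d2: "\<And>\<D> S. \<D> division_of S \<Longrightarrow> S \<subseteq> I \<Longrightarrow>
      (\<Sum>K\<in>\<D>. measure lborel K) < d2 \<Longrightarrow> (\<Sum>K\<in>\<D>. norm (g (Sup K) - g (Inf K))) < e/2"
    using g e2 unfolding abs_continuous_on_def by metis
  show "\<exists>\<delta>>0. \<forall>\<D> S. \<D> division_of S \<longrightarrow> S \<subseteq> I \<longrightarrow> (\<Sum>K\<in>\<D>. measure lborel K) < \<delta> \<longrightarrow>
        (\<Sum>K\<in>\<D>. norm (f (Sup K) - g (Sup K) - (f (Inf K) - g (Inf K)))) < e"
  proof (intro exI[of _ "min d1 d2"] conjI allI impI)
    show "min d1 d2 > 0" using \<open>d1 > 0\<close> \<open>d2 > 0\<close> by simp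
    fix \<D> S assume D: "\<D> division_of S" "S \<subseteq> I" "(\<Sum>K\<in>\<D>. measure lborel K) < min d1 d2"
    have "(\<Sum>K\<in>\<D>. norm (f (Sup K) - g (Sup K) - (f (Inf K) - g (Inf K))))
       \<le> (\<Sum>K\<in>\<D>. norm (f (Sup K) - f (Inf K)) + norm (g (Sup K) - g (Inf K)))"
      by (intro sum_mono) norm
    also have "\<dots> < e/2 + e/2"
      unfolding sum.distrib using d1[OF D(1,2)] d2[OF D(1,2)] D(3) by (intro add_strict_mono) auto
    finally show "(\<Sum>K\<in>\<D>. norm (f (Sup K) - g (Sup K) - (f (Inf K) - g (Inf K)))) < e" by simp
  qed
qed

text \<open>A division of total length below \<open>e/M\<close> has total increment at most
  \<open>M\<close> times that length. The derivatives of the solutions constructed below are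
  Lipschitz, as their forcing terms are bounded.\<close>

lemma abs_continuous_on_lipschitz:
  assumes L: "\<And>x y. x \<in> I \<Longrightarrow> y \<in> I \<Longrightarrow> norm (f x - f y) \<le> L * \<bar>x - y\<bar>"
  shows "abs_continuous_on I f"
  unfolding abs_continuous_on_def
proof (intro allI impI)
  fix e :: real assume "e > 0"
  define M where "M = \<bar>L\<bar> + 1"
  have M: "M > 0" "L \<le> M" unfolding M_def by auto
  show "\<exists>\<delta>>0. \<forall>\<D> S. \<D> division_of S \<longrightarrow> S \<subseteq> I \<longrightarrow> (\<Sum>K\<in>\<D>. measure lborel K) < \<delta> \<longrightarrow>
        (\<Sum>K\<in>\<D>. norm (f (Sup K) - f (Inf K))) < e"
  proof (intro exI[of _ "e/M"] conjI allI impI)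
    show "e/M > 0" using M \<open>e > 0\<close> by simp
    fix \<D> S assume D: "\<D> division_of S" "S \<subseteq> I" "(\<Sum>K\<in>\<D>. measure lborel K) < e/M"
    have "(\<Sum>K\<in>\<D>. norm (f (Sup K) - f (Inf K))) \<le> (\<Sum>K\<in>\<D>. M * measure lborel K)"
    proof (rule sum_mono)
      fix K assume "K \<in> \<D>"
      with D(1) obtain u v where uv: "K = {u..v}" "u \<le> v" "Inf K = u" "Sup K = v" "u \<in> S" "v \<in> S"
        by (rule division_of_real_endpoints)
      have "norm (f v - f u) \<le> L * \<bar>v - u\<bar>" using L uv D(2) by blast
      also have "\<dots> \<le> M * \<bar>v - u\<bar>" using M by (intro mult_right_mono) auto
      finally show "norm (f (Sup K) - f (Inf K)) \<le> M * measure lborel K" using uv by simp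
    qed
    also have "\<dots> < e" using D(3) M by (simp add: sum_distrib_left[symmetric] field_simps)
    finally show "(\<Sum>K\<in>\<D>. norm (f (Sup K) - f (Inf K))) < e" .
  qed
qed

text \<open>Solutions satisfy the equation only almost everywhere, so uniqueness needs this fact. A
  gauge splits a fine tagged division: at tags off the null set the zero derivative bounds
  increments by \<open>e\<close> times the length, while intervals tagged in the null set lie in an
  open set of measure below \<open>d\<close>, where absolute continuity bounds the total increment
  by \<open>e\<close>.\<close>

lemma abs_continuous_on_zero_derivative:
  fixes g :: "real \<Rightarrow> complex"
  assumes ac: "abs_continuous_on {A..B} g" and AB: "A \<le> B" and N: "negligible N"
    and der: "\<And>x. x \<in> {A<..<B} - N \<Longrightarrow> (g has_vector_derivative 0) (at x)"
  shows "g B = g A"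
proof -
  have main: "norm (g B - g A) \<le> e * (B - A) + e" if e: "e > 0" for e :: real
  proof -
    obtain d where "d > 0" and d: "\<And>\<D> S. \<D> division_of S \<Longrightarrow> S \<subseteq> {A..B} \<Longrightarrow>
        (\<Sum>K\<in>\<D>. measure lborel K) < d \<Longrightarrow> (\<Sum>K\<in>\<D>. norm (g (Sup K) - g (Inf K))) < e"
      using ac e unfolding abs_continuous_on_def by metis
    \<comment> \<open>The end points join the exceptional set because \<open>der\<close> says
      nothing about them.\<close>
    define N' where "N' = N \<union> {A,B}"
    have N': "negligible N'" unfolding N'_def using N
      by (metis negligible_Un negligible_finite finite.emptyI finite_insert)
    then have N's: "N' \<in> sets lebesgue" "N' \<in> null_sets lebesgue"
      by (auto simp: negligible_iff_null_sets)
    from sets_lebesgue_outer_open[OF N's(1) \<open>d > 0\<close>] obtain T where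
      T: "open T" "N' \<subseteq> T" "T - N' \<in> lmeasurable" "emeasure lebesgue (T - N') < ennreal d" by blast
    have Tm: "T \<in> lmeasurable"
    proof -
      have "T = (T - N') \<union> N'" using T by auto
      moreover have "(T - N') \<union> N' \<in> lmeasurable"
        using T(3) N' by (intro fmeasurable.Un) (auto simp: negligible_iff_measure)
      ultimately show ?thesis by simp
    qed
    have "measure lebesgue T = measure lebesgue (T - N')"
      using measure_Diff_null_set[OF _ N's(2), of T] Tm by (simp add: fmeasurableD)
    also have "\<dots> < d" using T(3,4) \<open>d > 0\<close>
      by (simp add: emeasure_eq_measure2 ennreal_less_iff)
    finally have Td: "measure lebesgue T < d" .
    have "\<exists>r>0. \<forall>y. \<bar>y - x\<bar> < r \<longrightarrow> norm (g y - g x) \<le> e * \<bar>y - x\<bar>" if x: "x \<in> {A<..<B} - N" for x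
    proof -
      have "(g has_derivative (\<lambda>_. 0)) (at x)"
        using der[OF x] by (simp add: has_vector_derivative_def)
      then show ?thesis unfolding has_derivative_at_alt using e by auto
    qed
    then obtain r where r: "\<And>x. x \<in> {A<..<B} - N \<Longrightarrow> r x > 0 \<and> (\<forall>y. \<bar>y - x\<bar> < r x \<longrightarrow> norm (g y - g x) \<le> e * \<bar>y - x\<bar>)"
      by metis
    \<comment> \<open>The value \<open>UNIV\<close> concerns only points outside
      \<open>{A..B}\<close>, which are never tags.\<close>
    define \<gamma> where "\<gamma> x = (if x \<in> N' then T else if x \<in> {A<..<B} then ball x (r x) else UNIV)" for x
    have "gauge \<gamma>" unfolding gauge_def \<gamma>_def using T r N'_def by auto
    then obtain p where p: "p tagged_division_of {A..B}" "\<gamma> fine p"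
      by (rule fine_division_exists_real)
    define p1 where "p1 = {xk \<in> p. fst xk \<in> N'}"
    define p2 where "p2 = {xk \<in> p. fst xk \<notin> N'}"
    have fin: "finite p" using p by auto
    have pp: "p = p1 \<union> p2" "p1 \<inter> p2 = {}" "finite p1" "finite p2" unfolding p1_def p2_def using fin by auto
    have ends: "\<exists>u v. K = {u..v} \<and> u \<le> x \<and> x \<le> v \<and> Inf K = u \<and> Sup K = v \<and> A \<le> u \<and> v \<le> B"
      if xk: "(x,K) \<in> p" for x K
    proof -
      from tagged_division_ofD(4)[OF p(1) xk] obtain u v where "K = cbox u v" by blast
      moreover have "x \<in> K" "K \<subseteq> {A..B}" using tagged_division_ofD(2,3)[OF p(1) xk] by auto
      ultimately show ?thesis by (intro exI[of _ u] exI[of _ v]) auto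
    qed
    have "g B - g A = (\<Sum>(x,K)\<in>p. g (Sup K) - g (Inf K))"
      using additive_tagged_division_1[OF AB p(1), of g] by simp
    also have "\<dots> = (\<Sum>(x,K)\<in>p1. g (Sup K) - g (Inf K)) + (\<Sum>(x,K)\<in>p2. g (Sup K) - g (Inf K))"
      using pp by (simp add: sum.union_disjoint)
    finally have eq: "norm (g B - g A) \<le> (\<Sum>(x,K)\<in>p1. norm (g (Sup K) - g (Inf K)))
        + (\<Sum>(x,K)\<in>p2. norm (g (Sup K) - g (Inf K)))"
      by (metis (no_types, lifting) norm_triangle_mono sum_norm_le split_def order_refl)
    have "(\<Sum>(x,K)\<in>p2. norm (g (Sup K) - g (Inf K))) \<le> (\<Sum>(x,K)\<in>p2. e * measure lborel K)"
    proof (rule sum_mono, clarify)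
      fix x K assume xk: "(x,K) \<in> p2"
      then have xp: "(x,K) \<in> p" and xN: "x \<notin> N'" unfolding p2_def by auto
      obtain u v where uv: "K = {u..v}" "u \<le> x" "x \<le> v" "Inf K = u" "Sup K = v" "A \<le> u" "v \<le> B"
        using ends[OF xp] by blast
      have xAB: "x \<in> {A<..<B} - N" using xN uv unfolding N'_def by auto
      have "K \<subseteq> ball x (r x)" using p(2) xp xN xAB unfolding fine_def \<gamma>_def by force
      moreover have "u \<in> K" "v \<in> K" using uv by simp_all
      ultimately have "u \<in> ball x (r x)" "v \<in> ball x (r x)" by blast+
      then have "norm (g u - g x) \<le> e * \<bar>u - x\<bar>" "norm (g v - g x) \<le> e * \<bar>v - x\<bar>"
        using r[OF xAB] by (auto simp: dist_real_def abs_minus_commute)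
      then have "norm (g v - g u) \<le> e * \<bar>u - x\<bar> + e * \<bar>v - x\<bar>"
        using norm_triangle_ineq4[of "g v - g x" "g u - g x"] by simp
      also have "\<dots> = e * (v - u)" using uv by (simp add: algebra_simps)
      finally show "norm (g (Sup K) - g (Inf K)) \<le> e * measure lborel K" using uv by simp
    qed
    also have "\<dots> \<le> (\<Sum>(x,K)\<in>p. e * measure lborel K)"
      using fin e pp by (intro sum_mono2) auto
    also have "\<dots> = e * (\<Sum>(x,K)\<in>p. measure lborel K)" by (simp add: sum_distrib_left split_def)
    also have "(\<Sum>(x,K)\<in>p. measure lborel K) = B - A"
      using additive_content_tagged_division[of p A B] p(1) AB by simp
    finally have b2: "(\<Sum>(x,K)\<in>p2. norm (g (Sup K) - g (Inf K))) \<le> e * (B - A)" .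
    have p1d: "p1 tagged_division_of (\<Union>(snd ` p1))"
    proof (rule tagged_partial_division_of_Union_self)
      show "p1 tagged_partial_division_of {A..B}"
        using p(1) pp(1) tagged_partial_division_subset[of p "{A..B}" p1]
        unfolding tagged_division_of_def by blast
    qed
    have dv: "snd ` p1 division_of (\<Union>(snd ` p1))" by (rule division_of_tagged_division[OF p1d])
    \<comment> \<open>Summing over the intervals instead of the tagged pairs requires the value 0 on
      degenerate boxes. The empty one needs its own case, as \<open>Inf {}\<close> and
      \<open>Sup {}\<close> carry no information.\<close>
    define D where "D K = (if K = {} then 0 else norm (g (Sup K) - g (Inf K)))" for K
    have nonempty: "K \<noteq> {}" if "(x,K) \<in> p1" for x K
      using tagged_division_ofD(2)[OF p1d that] by blast
    have "(\<Sum>(x,K)\<in>p1. norm (g (Sup K) - g (Inf K))) = (\<Sum>(x,K)\<in>p1. D K)"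
      using nonempty by (intro sum.cong) (auto simp: D_def)
    also have "\<dots> = (\<Sum>K\<in>snd ` p1. D K)"
    proof (rule sum.over_tagged_division_lemma[OF p1d])
      fix u v :: real assume "box u v = {}"
      then have "v \<le> u" by simp
      then show "D (cbox u v) = 0"
        by (cases "u = v") (auto simp: D_def)
    qed
    also have "\<dots> = (\<Sum>K\<in>snd ` p1. norm (g (Sup K) - g (Inf K)))"
      using nonempty by (intro sum.cong) (auto simp: D_def)
    also have "\<dots> < e"
    proof (rule d[OF dv])
      show "\<Union>(snd ` p1) \<subseteq> {A..B}"
        using tagged_division_ofD(3)[OF p(1)] unfolding p1_def by force
      have "(\<Sum>K\<in>snd ` p1. measure lborel K) = (\<Sum>K\<in>snd ` p1. measure lebesgue K)"
      proof (rule sum.cong)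
        fix K assume "K \<in> snd ` p1"
        with dv obtain u v where "K = {u..v}" by (metis division_of_real_endpoints)
        then show "measure lborel K = measure lebesgue K" by simp
      qed simp
      also have "\<dots> = measure lebesgue (\<Union>(snd ` p1))"
        using content_division[OF dv] by simp
      also have "\<dots> \<le> measure lebesgue T"
      proof (rule measure_mono_fmeasurable)
        show "\<Union>(snd ` p1) \<subseteq> T" using p(2) unfolding fine_def \<gamma>_def p1_def by fastforce
        show "\<Union>(snd ` p1) \<in> sets lebesgue"
        proof (rule sets.finite_Union)
          show "snd ` p1 \<subseteq> sets lebesgue"
          proof
            fix K assume "K \<in> snd ` p1"
            with dv obtain u v where "K = {u..v}" by (metis division_of_real_endpoints)
            then show "K \<in> sets lebesgue" by simp
          qed
        qed (use pp(3) in simp)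
      qed (rule Tm)
      finally show "(\<Sum>K\<in>snd ` p1. measure lborel K) < d" using Td by simp
    qed
    finally show ?thesis using eq b2 by linarith
  qed
  have "norm (g B - g A) \<le> 0"
  proof (rule field_le_epsilon)
    fix e :: real assume e: "e > 0"
    have pos: "B - A + 1 > 0" using AB by simp
    define e' where "e' = e/(B - A + 1)"
    have e': "e' > 0" "e' * (B - A + 1) = e" unfolding e'_def using e pos by simp_all
    have "norm (g B - g A) \<le> e' * (B - A) + e'" by (rule main[OF e'(1)])
    also have "\<dots> = e" using e'(2) by (simp add: distrib_left)
    finally show "norm (g B - g A) \<le> 0 + e" by simp
  qed
  then show ?thesis by simp
qed

subsection \<open>Solutions without delay\<close>

text \<open>\<open>cs l\<close> and \<open>sn l\<close> solve \<open>- y'' = l y\<close> with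
  initial data (1,0) and (0,1). Both are even in the square root, so its branch is immaterial; the
  value of \<open>sn\<close> at \<open>l = 0\<close> is the limit, which division by zero would not
  give.\<close>

definition cs :: "complex \<Rightarrow> real \<Rightarrow> complex" where
  "cs l x = cos (csqrt l * of_real x)"

definition sn :: "complex \<Rightarrow> real \<Rightarrow> complex" where
  "sn l x = (if l = 0 then of_real x else sin (csqrt l * of_real x) / csqrt l)"

lemma csqrt_mult_self [simp]: "csqrt l * csqrt l = l"
  by (metis power2_csqrt power2_eq_square)

lemma cs_0 [simp]: "cs l 0 = 1" and sn_0 [simp]: "sn l 0 = 0"
  by (simp_all add: cs_def sn_def)

lemma csqrt_mult_self_left [simp]: "csqrt l * (csqrt l * z) = l * z"
  by (simp add: mult.assoc[symmetric])

lemma has_vector_derivative_cs: "(cs l has_vector_derivative - l * sn l x) (at x within T)"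
proof -
  have "((\<lambda>z. cos (csqrt l * z)) has_field_derivative - sin (csqrt l * of_real x) * csqrt l) (at (of_real x))"
    by (auto intro!: derivative_eq_intros)
  from has_vector_derivative_real_field[OF this] 
  have "(cs l has_vector_derivative - sin (csqrt l * of_real x) * csqrt l) (at x within T)"
    unfolding cs_def[abs_def] .
  moreover have "- sin (csqrt l * of_real x) * csqrt l = - l * sn l x"
    using csqrt_mult_self[of l] by (cases "l = 0") (auto simp: sn_def field_simps)
  ultimately show ?thesis by simp
qed

lemma has_vector_derivative_sn: "(sn l has_vector_derivative cs l x) (at x within T)"
proof (cases "l = 0")
  case True
  have "(of_real has_vector_derivative (1::complex)) (at x within T)"
    using has_vector_derivative_of_real[of "\<lambda>x. x" 1] by simp
  then show ?thesis using True by (simp add: sn_def[abs_def] cs_def)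
next
  case False
  have "((\<lambda>z. sin (csqrt l * z) / csqrt l) has_field_derivative cos (csqrt l * of_real x)) (at (of_real x))"
    using False by (auto intro!: derivative_eq_intros simp del: csqrt_mult_self csqrt_mult_self_left)
  from has_vector_derivative_real_field[OF this] 
  show ?thesis using False unfolding cs_def[abs_def] sn_def[abs_def] by simp
qed

lemma cs_add: "cs l (x + y) = cs l x * cs l y - l * sn l x * sn l y"
  using csqrt_mult_self[of l] by (cases "l = 0") (auto simp: sn_def cs_def algebra_simps cos_add field_simps)

lemma sn_add: "sn l (x + y) = sn l x * cs l y + cs l x * sn l y"
  by (cases "l = 0") (auto simp: sn_def cs_def algebra_simps sin_add add_divide_distrib)

lemma cs_minus [simp]: "cs l (- x) = cs l x" and sn_minus [simp]: "sn l (- x) = - sn l x"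
  by (auto simp: cs_def sn_def)

text \<open>The Wronskian of the two free solutions, obtained from the addition formula at
  \<open>x + (- x) = 0\<close>.\<close>

lemma cs_sn_square: "cs l x * cs l x + l * sn l x * sn l x = 1"
  using cs_add[of l x "-x"] by simp

lemma cs_UNIV: "continuous_on UNIV (cs l)" and sn_UNIV: "continuous_on UNIV (sn l)"
  using has_vector_derivative_cs has_vector_derivative_sn
  by (auto intro!: continuous_at_imp_continuous_on has_vector_derivative_continuous)

lemma continuous_on_cs [continuous_intros]: "continuous_on T g \<Longrightarrow> continuous_on T (\<lambda>x. cs l (g x))"
  by (rule continuous_on_compose2[OF cs_UNIV]) auto

lemma continuous_on_sn [continuous_intros]: "continuous_on T g \<Longrightarrow> continuous_on T (\<lambda>x. sn l (g x))"
  by (rule continuous_on_compose2[OF sn_UNIV]) auto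

subsection \<open>Piecewise continuous forcing terms\<close>

text \<open>The exceptional set is a parameter because derivatives are taken off it, and its
  finiteness lets the fundamental theorem pass over the jumps. Boundedness and measurability give
  integrability against continuous kernels.\<close>

definition piecewise_cont :: "real set \<Rightarrow> (real \<Rightarrow> complex) \<Rightarrow> bool" where
  "piecewise_cont N r \<longleftrightarrow> finite N \<and> r \<in> borel_measurable borel \<and> bounded (range r) \<and> (\<forall>x. x \<notin> N \<longrightarrow> isCont r x)"

definition window :: "real \<Rightarrow> real \<Rightarrow> (real \<Rightarrow> complex) \<Rightarrow> real \<Rightarrow> complex" where
  "window b b' g x = (if x \<in> {b..b'} then g x else 0)"

lemma piecewise_cont_window:
  assumes g: "continuous_on {b..b'} g"
  shows "piecewise_cont {b,b'} (window b b' g)"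
proof -
  have "window b b' g = (\<lambda>x. indicator {b..b'} x *\<^sub>R g x)" by (auto simp: window_def)
  then have m: "window b b' g \<in> borel_measurable borel"
    using borel_measurable_continuous_on_indicator[OF _ g] by simp
  have "bounded (g ` {b..b'})" by (intro compact_imp_bounded compact_continuous_image g) simp
  then have "bounded (insert 0 (g ` {b..b'}))" by simp
  then have bd: "bounded (range (window b b' g))"
    by (rule bounded_subset) (auto simp: window_def)
  have "isCont (window b b' g) x" if "x \<notin> {b,b'}" for x
  proof (cases "x \<in> {b<..<b'}")
    case True
    have "continuous_on {b<..<b'} g" using g by (rule continuous_on_subset) auto
    then have "continuous_on {b<..<b'} (window b b' g)" by (rule continuous_on_eq) (auto simp: window_def)
    then show ?thesis using True by (simp add: continuous_on_eq_continuous_at)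
  next
    case False
    have "continuous_on (- {b..b'}) (window b b' g)"
      by (rule continuous_on_eq[OF continuous_on_const[of _ 0]]) (auto simp: window_def)
    moreover have "x \<in> - {b..b'}" using False that by auto
    ultimately show ?thesis by (metis continuous_on_eq_continuous_at closed_atLeastAtMost open_Compl)
  qed
  with m bd show ?thesis unfolding piecewise_cont_def by auto
qed

lemma piecewise_cont_add: "piecewise_cont M r \<Longrightarrow> piecewise_cont N s \<Longrightarrow> piecewise_cont (M \<union> N) (\<lambda>x. r x + s x)"
  unfolding piecewise_cont_def by (auto intro!: borel_measurable_add bounded_plus_comp continuous_add)

lemma piecewise_cont_cmult:
  assumes "piecewise_cont M r"
  shows "piecewise_cont M (\<lambda>x. c * r x)"
proof -
  from assms obtain K where "\<And>x. norm (r x) \<le> K" unfolding piecewise_cont_def bounded_iff by auto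
  then have "\<And>x. norm (c * r x) \<le> norm c * K" by (simp add: norm_mult mult_left_mono)
  then have "bounded (range (\<lambda>x. c * r x))" unfolding bounded_iff by blast
  with assms show ?thesis unfolding piecewise_cont_def by (auto intro!: borel_measurable_times continuous_intros)
qed

lemma continuous_on_Icc_bounded:
  fixes k :: "real \<Rightarrow> complex"
  assumes "continuous_on {u..v} k"
  shows "\<exists>K. \<forall>x\<in>{u..v}. norm (k x) \<le> K"
proof -
  have "bounded (k ` {u..v})"
    using assms by (intro compact_imp_bounded compact_continuous_image) auto
  then show ?thesis by (simp add: bounded_iff)
qed

lemma piecewise_cont_integrable:
  assumes r: "piecewise_cont N r" and k: "continuous_on {u..v} k"
  shows "(\<lambda>t. k t * r t) integrable_on {u..v}"
proof -
  from r obtain M where M: "\<And>x. norm (r x) \<le> M" unfolding piecewise_cont_def bounded_iff by auto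
  obtain K where K: "\<And>x. x \<in> {u..v} \<Longrightarrow> norm (k x) \<le> K"
    using continuous_on_Icc_bounded[OF k] by blast
  show ?thesis
  proof (rule measurable_bounded_by_integrable_imp_integrable)
    have "k \<in> borel_measurable (lebesgue_on {u..v})"
      using k by (intro continuous_imp_measurable_on_sets_lebesgue) auto
    moreover have "r \<in> borel_measurable (lebesgue_on {u..v})"
      using r unfolding piecewise_cont_def by (auto intro!: measurable_restrict_space1 measurable_completion)
    ultimately show "(\<lambda>t. k t * r t) \<in> borel_measurable (lebesgue_on {u..v})"
      by (intro borel_measurable_times)
    fix x assume "x \<in> {u..v}"
    then have "0 \<le> K" using K by (metis norm_ge_zero order_trans)
    then show "norm (k x * r x) \<le> K * M" unfolding norm_mult
      using K[OF \<open>x \<in> {u..v}\<close>] M by (intro mult_mono) auto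
  qed auto
qed

lemma integral_mult_window:
  assumes "0 \<le> b"
  shows "integral {0..x} (\<lambda>t. k t * window b b' g t) = integral {b..min b' x} (\<lambda>t. k t * g t)"
proof -
  have "integral {0..x} (\<lambda>t. k t * window b b' g t) = integral {0..x} (\<lambda>t. if t \<in> {b..b'} then k t * g t else 0)"
    by (intro integral_cong) (auto simp: window_def)
  also have "\<dots> = integral ({b..b'} \<inter> {0..x}) (\<lambda>t. k t * g t)" by (rule integral_restrict_Int)
  also have "{b..b'} \<inter> {0..x} = {b..min b' x}" using assms by auto
  finally show ?thesis .
qed

subsection \<open>The Duhamel integral\<close>

text \<open>This is the integral of \<open>sn l (x - t) * r t\<close> over \<open>{0..x}\<close>,
  and \<open>duhamel'\<close> the same with kernel \<open>cs l (x - t)\<close>. The addition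
  formulas have been applied so that \<open>x\<close> occurs only outside the integrands and in the
  limits.\<close>

definition duhamel :: "complex \<Rightarrow> (real \<Rightarrow> complex) \<Rightarrow> real \<Rightarrow> complex" where
  "duhamel l r x = sn l x * integral {0..x} (\<lambda>t. cs l t * r t) - cs l x * integral {0..x} (\<lambda>t. sn l t * r t)"

definition duhamel' :: "complex \<Rightarrow> (real \<Rightarrow> complex) \<Rightarrow> real \<Rightarrow> complex" where
  "duhamel' l r x = cs l x * integral {0..x} (\<lambda>t. cs l t * r t) + l * sn l x * integral {0..x} (\<lambda>t. sn l t * r t)"

lemma duhamel_0 [simp]: "duhamel l r 0 = 0" "duhamel' l r 0 = 0" by (simp_all add: duhamel_def duhamel'_def)

lemma duhamel_cong:
  assumes "\<And>t. 0 \<le> t \<Longrightarrow> t \<le> x \<Longrightarrow> r t = s t"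
  shows "duhamel l r x = duhamel l s x" "duhamel' l r x = duhamel' l s x"
proof -
  have "integral {0..x} (\<lambda>t. k t * r t) = integral {0..x} (\<lambda>t. k t * s t)" for k
    by (intro integral_cong) (use assms in auto)
  then show "duhamel l r x = duhamel l s x" "duhamel' l r x = duhamel' l s x" unfolding duhamel_def duhamel'_def by simp_all
qed

lemma duhamel_add_cmult:
  assumes r: "piecewise_cont M r" and s: "piecewise_cont N s"
  shows "duhamel l (\<lambda>t. r t + c * s t) x = duhamel l r x + c * duhamel l s x"
    "duhamel' l (\<lambda>t. r t + c * s t) x = duhamel' l r x + c * duhamel' l s x"
proof -
  have "integral {0..x} (\<lambda>t. k t * (r t + c * s t)) = integral {0..x} (\<lambda>t. k t * r t) + c * integral {0..x} (\<lambda>t. k t * s t)" 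
    if k: "continuous_on {0..x} k" for k
  proof -
    have "integral {0..x} (\<lambda>t. k t * (r t + c * s t)) = integral {0..x} (\<lambda>t. k t * r t + c * (k t * s t))"
      by (intro integral_cong) (simp add: algebra_simps)
    also have "\<dots> = integral {0..x} (\<lambda>t. k t * r t) + integral {0..x} (\<lambda>t. c * (k t * s t))"
      using piecewise_cont_integrable[OF r k] piecewise_cont_integrable[OF s k] by (intro integral_add integrable_on_mult_right) auto
    finally show ?thesis by simp
  qed
  note this[OF continuous_on_cs[OF continuous_on_id, of _ l]] this[OF continuous_on_sn[OF continuous_on_id, of _ l]]
  then show "duhamel l (\<lambda>t. r t + c * s t) x = duhamel l r x + c * duhamel l s x"
    "duhamel' l (\<lambda>t. r t + c * s t) x = duhamel' l r x + c * duhamel' l s x"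
    unfolding duhamel_def duhamel'_def by (simp_all add: algebra_simps)
qed

lemma has_vector_derivative_indefinite:
  assumes r: "piecewise_cont N r" and k: "continuous_on UNIV k" and x: "0 < x" "x \<notin> N"
  shows "((\<lambda>x. integral {0..x} (\<lambda>t. k t * r t)) has_vector_derivative k x * r x) (at x)"
proof -
  have k': "continuous_on {0..x+1} k" using k by (rule continuous_on_subset) simp
  have "isCont k x" using k by (simp add: continuous_on_eq_continuous_at)
  moreover have "isCont r x" using r x unfolding piecewise_cont_def by simp
  ultimately have c: "continuous (at x within ({0..x+1} - {})) (\<lambda>t. k t * r t)"
    by (rule continuous_at_imp_continuous_at_within[OF continuous_mult])
  have "((\<lambda>x. integral {0..x} (\<lambda>t. k t * r t)) has_vector_derivative k x * r x) (at x within ({0..x+1} - {}))"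
    by (rule integral_has_vector_derivative_continuous_at[OF piecewise_cont_integrable[OF r k'] _ _ c]) (use x in auto)
  then have "((\<lambda>x. integral {0..x} (\<lambda>t. k t * r t)) has_vector_derivative k x * r x) (at x within {0..x+1})"
    by simp
  then show ?thesis using x by (simp add: at_within_Icc_at)
qed

lemma continuous_on_indefinite:
  assumes r: "piecewise_cont N r" and k: "continuous_on UNIV k"
  shows "continuous_on {0..b} (\<lambda>x. integral {0..x} (\<lambda>t. k t * r t))"
  using k by (intro indefinite_integral_continuous_1 piecewise_cont_integrable[OF r]) (rule continuous_on_subset, auto)

lemma continuous_on_duhamel:
  assumes r: "piecewise_cont N r"
  shows "continuous_on {0..b} (duhamel l r)" "continuous_on {0..b} (duhamel' l r)"
  unfolding duhamel_def[abs_def] duhamel'_def[abs_def]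
  by (intro continuous_intros continuous_on_indefinite[OF r] cs_UNIV sn_UNIV)+

text \<open>Variation of parameters: the terms with \<open>r\<close> cancel in the first derivative
  and add up to \<open>r\<close> by \<open>cs_sn_square\<close> in the second, so
  \<open>y'' + l y = r\<close> holds away from the jumps.\<close>

lemma duhamel_derivs_interior:
  assumes r: "piecewise_cont N r" and x: "0 < x" "x \<notin> N"
  shows "(duhamel l r has_vector_derivative duhamel' l r x) (at x)"
    "(duhamel' l r has_vector_derivative r x - l * duhamel l r x) (at x)"
proof -
  note A = has_vector_derivative_indefinite[OF r cs_UNIV x, of l]
  note B = has_vector_derivative_indefinite[OF r sn_UNIV x, of l]
  show "(duhamel l r has_vector_derivative duhamel' l r x) (at x)"
    unfolding duhamel_def[abs_def]
    apply (rule has_vector_derivative_eq_rhs)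
     apply (rule has_vector_derivative_diff[OF has_vector_derivative_mult[OF has_vector_derivative_sn A]
          has_vector_derivative_mult[OF has_vector_derivative_cs B]])
    by (simp add: duhamel'_def algebra_simps)
  have eq: "cs l x * (cs l x * r x) + l * (sn l x * (sn l x * r x)) = r x"
    using arg_cong[OF cs_sn_square[of l x], of "\<lambda>z. z * r x"] by (simp add: algebra_simps)
  show "(duhamel' l r has_vector_derivative r x - l * duhamel l r x) (at x)"
    unfolding duhamel'_def[abs_def] mult.assoc
    apply (rule has_vector_derivative_eq_rhs)
     apply (rule has_vector_derivative_add[OF has_vector_derivative_mult[OF has_vector_derivative_cs A]
          has_vector_derivative_mult[OF has_vector_derivative_const[of l] has_vector_derivative_mult[OF has_vector_derivative_sn B]]])
    by (subst eq[symmetric]) (simp add: duhamel_def algebra_simps)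
qed

lemma duhamel_deriv:
  assumes r: "piecewise_cont N r" and x: "x \<in> {0..b}"
  shows "(duhamel l r has_vector_derivative duhamel' l r x) (at x within {0..b})"
proof -
  have hi: "(duhamel' l r has_integral duhamel l r y - duhamel l r 0) {0..y}" if "y \<in> {0..b}" for y
  proof (rule fundamental_theorem_of_calculus_interior_strong[where S=N])
    show "finite N" using r by (simp add: piecewise_cont_def)
    show "continuous_on {0..y} (duhamel l r)" by (rule continuous_on_duhamel[OF r])
    show "(duhamel l r has_vector_derivative duhamel' l r x) (at x)" if "x \<in> {0<..<y} - N" for x
      using duhamel_derivs_interior[OF r] that by auto
  qed (use that in auto)
  then have eq: "duhamel l r y = integral {0..y} (duhamel' l r)" if "y \<in> {0..b}" for y
    using integral_unique[OF hi[OF that]] by simp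
  have "((\<lambda>y. integral {0..y} (duhamel' l r)) has_vector_derivative duhamel' l r x) (at x within {0..b})"
    by (rule integral_has_vector_derivative[OF continuous_on_duhamel(2)[OF r] x])
  from has_vector_derivative_transform[OF x eq this] show ?thesis .
qed

lemma has_integral_imp_lipschitz:
  fixes f :: "real \<Rightarrow> complex"
  assumes f: "\<And>u v. a \<le> u \<Longrightarrow> u \<le> v \<Longrightarrow> v \<le> b \<Longrightarrow> (f' has_integral f v - f u) {u..v}"
    and K: "\<And>x. x \<in> {a..b} \<Longrightarrow> norm (f' x) \<le> K"
    and xy: "x \<in> {a..b}" "y \<in> {a..b}"
  shows "norm (f x - f y) \<le> \<bar>K\<bar> * \<bar>x - y\<bar>"
proof -
  have le: "norm (f v - f u) \<le> \<bar>K\<bar> * (v - u)" if uv: "a \<le> u" "u \<le> v" "v \<le> b" for u v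
  proof -
    have "norm (f' x) \<le> \<bar>K\<bar>" if "x \<in> {u..v}" for x
    proof -
      have "x \<in> {a..b}" using that uv by auto
      from K[OF this] show ?thesis by linarith
    qed
    then have "norm (f v - f u) \<le> \<bar>K\<bar> * measure lborel (cbox u v)"
      using f[OF uv] by (intro has_integral_bound[of _ f']) auto
    then show ?thesis using uv by simp
  qed
  show ?thesis using le[of x y] le[of y x] xy by (cases "x \<le> y") (auto simp: norm_minus_commute)
qed

text \<open>Off the jumps the derivative \<open>r - l * duhamel l r\<close> is bounded, and
  \<open>duhamel'\<close> is still its integral across them.\<close>

lemma duhamel'_lipschitz:
  assumes r: "piecewise_cont N r"
  obtains L where "\<And>x y. x \<in> {0..b} \<Longrightarrow> y \<in> {0..b} \<Longrightarrow> norm (duhamel' l r x - duhamel' l r y) \<le> L * \<bar>x - y\<bar>"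
proof -
  from r obtain M where M: "\<And>x. norm (r x) \<le> M" unfolding piecewise_cont_def bounded_iff by auto
  obtain K where K: "\<And>x. x \<in> {0..b} \<Longrightarrow> norm (duhamel l r x) \<le> K"
    using continuous_on_Icc_bounded[OF continuous_on_duhamel(1)[OF r]] by blast
  have hi: "((\<lambda>x. r x - l * duhamel l r x) has_integral duhamel' l r v - duhamel' l r u) {u..v}"
    if uv: "0 \<le> u" "u \<le> v" "v \<le> b" for u v
  proof (rule fundamental_theorem_of_calculus_interior_strong[where S=N])
    show "finite N" using r by (simp add: piecewise_cont_def)
    show "continuous_on {u..v} (duhamel' l r)"
      by (rule continuous_on_subset[OF continuous_on_duhamel(2)[OF r, of b]]) (use uv in auto)
    show "(duhamel' l r has_vector_derivative r x - l * duhamel l r x) (at x)" if "x \<in> {u<..<v} - N" for x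
      using duhamel_derivs_interior[OF r] that uv by auto
  qed (use uv in auto)
  have bd: "norm (r x - l * duhamel l r x) \<le> M + norm l * K" if "x \<in> {0..b}" for x
    using M[of x] norm_triangle_ineq4[of "r x" "l * duhamel l r x"] mult_left_mono[OF K[OF that], of "norm l"]
    by (simp add: norm_mult)
  show thesis
    using has_integral_imp_lipschitz[where f = "duhamel' l r", OF hi bd] by (rule that)
qed

subsection \<open>Uniqueness of solutions of the delay equation\<close>

lemma dd_simps: "dd 0 f = f" "dd (Suc 0) f = (\<lambda>x. vector_derivative f (at x within {0..pi}))"
  by (simp_all add: dd_def)

lemma is_solution_deriv:
  assumes "is_solution a q l y" "x \<in> {0..pi}"
  shows "(y has_vector_derivative dd 1 y x) (at x within {0..pi})"
  using assms unfolding is_solution_def by (simp add: dd_simps vector_derivative_works[symmetric])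

lemma AE_lebesgue_on_negligible:
  fixes S :: "real set"
  assumes "S \<in> sets lebesgue"
  shows "(AE x in lebesgue_on S. P x) \<longleftrightarrow> (\<exists>N. negligible N \<and> (\<forall>x\<in>S - N. P x))"
proof -
  have "(AE x in lebesgue_on S. P x) \<longleftrightarrow> (AE x in lebesgue. x \<in> S \<longrightarrow> P x)"
    using assms by (intro AE_restrict_space_iff) auto
  also have "\<dots> \<longleftrightarrow> (\<exists>N\<in>null_sets lebesgue. {x. \<not> (x \<in> S \<longrightarrow> P x)} \<subseteq> N)"
    by (simp add: eventually_ae_filter)
  also have "\<dots> \<longleftrightarrow> (\<exists>N. negligible N \<and> (\<forall>x\<in>S - N. P x))"
    by (auto simp: negligible_iff_null_sets subset_eq Bex_def)
  finally show ?thesis .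
qed

text \<open>The Wronskian-type expressions of \<open>w\<close> with \<open>sn l\<close> and
  \<open>cs l\<close> are constant, hence 0 by the initial data. They form a linear system for
  \<open>w\<close> and \<open>w1\<close> with determinant 1 by \<open>cs_sn_square\<close>.\<close>

lemma homogeneous_zero:
  fixes w w1 :: "real \<Rightarrow> complex"
  assumes w: "\<And>x. x \<in> {0..X} \<Longrightarrow> (w has_vector_derivative w1 x) (at x within {0..X})"
    and w1: "\<And>x. x \<in> {0..X} \<Longrightarrow> (w1 has_vector_derivative - l * w x) (at x within {0..X})"
    and init: "w 0 = 0" "w1 0 = 0" and x: "x \<in> {0..X}"
  shows "w x = 0"
proof -
  have const: "f x = f 0" if "\<And>x. x \<in> {0..X} \<Longrightarrow> (f has_vector_derivative 0) (at x within {0..X})"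
    for f :: "real \<Rightarrow> complex"
  proof -
    have "convex {0..X}" by simp
    from has_vector_derivative_zero_constant[OF this that] obtain c where "\<And>y. y \<in> {0..X} \<Longrightarrow> f y = c"
      by blast
    then show ?thesis using x by simp
  qed
  have c1: "sn l x * w1 x - cs l x * w x = 0"
  proof -
    have "((\<lambda>x. sn l x * w1 x - cs l x * w x) has_vector_derivative 0) (at x within {0..X})"
      if x: "x \<in> {0..X}" for x
      by (rule has_vector_derivative_eq_rhs[OF has_vector_derivative_diff[OF
          has_vector_derivative_mult[OF has_vector_derivative_sn w1[OF x]] 
          has_vector_derivative_mult[OF has_vector_derivative_cs w[OF x]]]])
         (simp add: algebra_simps)
    from const[OF this] show ?thesis using init by simp
  qed
  have c2: "cs l x * w1 x + l * (sn l x * w x) = 0"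
  proof -
    have "((\<lambda>x. cs l x * w1 x + l * (sn l x * w x)) has_vector_derivative 0) (at x within {0..X})"
      if x: "x \<in> {0..X}" for x
      by (rule has_vector_derivative_eq_rhs[OF has_vector_derivative_add[OF
          has_vector_derivative_mult[OF has_vector_derivative_cs w1[OF x]] 
          has_vector_derivative_mult[OF has_vector_derivative_const[of l] 
          has_vector_derivative_mult[OF has_vector_derivative_sn w[OF x]]]]])
         (simp add: algebra_simps)
    from const[OF this] show ?thesis using init by simp
  qed
  have "w x = (cs l x * cs l x + l * sn l x * sn l x) * w x" by (simp only: cs_sn_square mult_1)
  also have "\<dots> = sn l x * (cs l x * w1 x + l * (sn l x * w x)) - cs l x * (sn l x * w1 x - cs l x * w x)"
    by (simp add: algebra_simps)
  finally show ?thesis by (simp add: c1 c2)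
qed

text \<open>Method of steps: if the difference \<open>w\<close> vanishes up to \<open>n * a\<close>,
  the delayed term vanishes up to \<open>(n + 1) * a\<close>, and there \<open>w\<close> solves the
  homogeneous equation without delay.\<close>

lemma is_solution_unique:
  assumes a: "a > 0" and y: "is_solution a q l y" and z: "is_solution a q l z"
    and init: "y 0 = z 0" "dd 1 y 0 = dd 1 z 0"
    and out: "\<And>x. x \<notin> {0..pi} \<Longrightarrow> y x = z x"
  shows "y = z"
proof -
  define w where "w x = y x - z x" for x
  define w1 where "w1 x = dd 1 y x - dd 1 z x" for x
  have w: "(w has_vector_derivative w1 x) (at x within {0..pi})" if "x \<in> {0..pi}" for x
    unfolding w_def[abs_def] w1_def
    by (intro has_vector_derivative_diff is_solution_deriv[OF y that] is_solution_deriv[OF z that])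
  have wc: "continuous_on {0..pi} w"
    using w has_vector_derivative_continuous by (force simp: continuous_on_eq_continuous_within)
  have ac: "abs_continuous_on {0..pi} w1"
    unfolding w1_def[abs_def] using y z by (intro abs_continuous_on_diff) (simp_all add: is_solution_def)
  have "\<exists>N. negligible N \<and> (\<forall>x\<in>{0<..<pi} - N. (w1 has_vector_derivative q x * w (x - a) - l * w x) (at x))"
  proof -
    have "AE x in lebesgue_on {0<..<pi}. (\<exists>y2. (dd 1 y has_vector_derivative y2) (at x) \<and> - y2 + q x * y (x - a) = l * y x)
       \<and> (\<exists>y2. (dd 1 z has_vector_derivative y2) (at x) \<and> - y2 + q x * z (x - a) = l * z x)"
      using y z by (simp add: is_solution_def)
    then obtain N where "negligible N" and N: "\<And>x. x\<in>{0<..<pi} - N \<Longrightarrow> (\<exists>y2. (dd 1 y has_vector_derivative y2) (at x) \<and> - y2 + q x * y (x - a) = l * y x)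
       \<and> (\<exists>y2. (dd 1 z has_vector_derivative y2) (at x) \<and> - y2 + q x * z (x - a) = l * z x)"
      by (subst (asm) AE_lebesgue_on_negligible) auto
    have "(w1 has_vector_derivative q x * w (x - a) - l * w x) (at x)" if "x\<in>{0<..<pi} - N" for x
    proof -
      from N[OF that] obtain y2 z2 where yz: "(dd 1 y has_vector_derivative y2) (at x)" "(dd 1 z has_vector_derivative z2) (at x)"
        and "- y2 + q x * y (x - a) = l * y x" "- z2 + q x * z (x - a) = l * z x" by blast
      then have "y2 - z2 = q x * w (x - a) - l * w x" 
        unfolding w_def by algebra
      with has_vector_derivative_diff[OF yz] show ?thesis unfolding w1_def[abs_def] by simp
    qed
    with \<open>negligible N\<close> show ?thesis by blast
  qed
  then obtain N where N: "negligible N" and 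
    w2: "\<And>x. x\<in>{0<..<pi} - N \<Longrightarrow> (w1 has_vector_derivative q x * w (x - a) - l * w x) (at x)" by blast
  \<comment> \<open>The relation \<open>w1' = - l * w\<close> is known only almost everywhere.
    Comparing \<open>w1\<close> with \<open>- l * u\<close>, which has that derivative everywhere,
    upgrades it to all points.\<close>
  define u where "u x = integral {0..x} w" for x
  have u: "(u has_vector_derivative w x) (at x within {0..pi})" if "x \<in> {0..pi}" for x
    unfolding u_def[abs_def] by (rule integral_has_vector_derivative[OF wc that])
  have uac: "abs_continuous_on {0..pi} (\<lambda>x. - l * u x)"
  proof -
    obtain K where K: "\<And>x. x \<in> {0..pi} \<Longrightarrow> norm (- l * w x) \<le> K"
      using continuous_on_Icc_bounded[OF continuous_on_mult_left[OF wc, of "-l"]] by blast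
    have "((\<lambda>x. - l * w x) has_integral - l * u v - - l * u s) {s..v}" if "0 \<le> s" "s \<le> v" "v \<le> pi" for s v
    proof (rule fundamental_theorem_of_calculus[OF that(2)])
      fix x assume x: "x \<in> {s..v}"
      have "(u has_vector_derivative w x) (at x within {s..v})"
        by (rule has_vector_derivative_within_subset[OF u]) (use x that in auto)
      then show "((\<lambda>x. - l * u x) has_vector_derivative - l * w x) (at x within {s..v})"
        by (rule has_vector_derivative_mult_right)
    qed
    from has_integral_imp_lipschitz[where f="\<lambda>x. - l * u x", OF this K] 
    show ?thesis by (rule abs_continuous_on_lipschitz)
  qed
  have w10: "w 0 = 0" "w1 0 = 0" using init by (simp_all add: w_def w1_def)
  have u0: "u 0 = 0" by (simp add: u_def)
  have step: "\<forall>x\<in>{0..pi}. x \<le> real n * a \<longrightarrow> w x = 0" for n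
  proof (induction n)
    case 0
    show ?case using w10 by auto
  next
    case (Suc n)
    define X where "X = min pi (real (Suc n) * a)"
    have X: "0 \<le> X" "X \<le> pi" "X \<le> real (Suc n) * a" using a by (auto simp: X_def)
    have del: "w (x - a) = 0" if "x \<in> {0..X}" for x
    proof (cases "x - a \<in> {0..pi}")
      case True
      have "x - a \<le> real n * a" using that X by (auto simp: algebra_simps)
      then show ?thesis using Suc True by blast
    next
      \<comment> \<open>Here \<open>x - a\<close> is negative, where both functions agree by
        \<open>out\<close>.\<close>
      case False
      then show ?thesis using out by (simp add: w_def)
    qed
    have w1u: "w1 x = - l * u x" if x: "x \<in> {0..X}" for x
    proof -
      have "w1 x - - l * u x = w1 0 - - l * u 0"
      proof (rule abs_continuous_on_zero_derivative[where N=N])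
        show "abs_continuous_on {0..x} (\<lambda>x. w1 x - - l * u x)"
          by (rule abs_continuous_on_subset[OF abs_continuous_on_diff[OF ac uac]]) (use x X in auto)
        show "((\<lambda>x. w1 x - - l * u x) has_vector_derivative 0) (at t)" if t: "t \<in> {0<..<x} - N" for t
        proof -
          have t': "t \<in> {0<..<pi} - N" "t \<in> {0..pi}" "t \<in> {0..X}" "t \<in> interior {0..pi}" using t x X by auto
          have "(u has_vector_derivative w t) (at t)" using u[OF t'(2)] at_within_interior[OF t'(4)] by simp
          from has_vector_derivative_diff[OF w2[OF t'(1)] has_vector_derivative_mult_right[OF this, of "-l"]]
          show ?thesis using del[OF t'(3)] by simp
        qed
      qed (use x N in auto)
      then show ?thesis using w10 u0 by (simp add: add_eq_0_iff2)
    qed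
    have "w x = 0" if "x \<in> {0..X}" for x
    proof (rule homogeneous_zero[of X w w1 l])
      fix x assume x: "x \<in> {0..X}"
      show "(w has_vector_derivative w1 x) (at x within {0..X})"
        by (rule has_vector_derivative_within_subset[OF w]) (use x X in auto)
      have "((\<lambda>x. - l * u x) has_vector_derivative - l * w x) (at x within {0..X})"
        by (intro has_vector_derivative_mult_right has_vector_derivative_within_subset[OF u]) (use x X in auto)
      then show "(w1 has_vector_derivative - l * w x) (at x within {0..X})"
        by (rule has_vector_derivative_transform[OF x w1u, rotated])
    qed (use that w10 in auto)
    then show ?case unfolding X_def by auto
  qed
  obtain n where "pi \<le> real n * a" using a reals_Archimedean3 less_imp_le by blast
  then have "w x = 0" if "x \<in> {0..pi}" for x using step[of n] that by auto
  then have "w x = 0" for x using out by (cases "x \<in> {0..pi}") (auto simp: w_def)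
  then show ?thesis unfolding w_def by auto
qed

lemma sol_eq:
  assumes a: "a > 0" and y: "is_solution a q l y"
    and init: "\<forall>i\<in>{0,1}. dd i y 0 = (if \<mu> = i then 1 else 0)"
    and out: "\<forall>x. x \<notin> {0..pi} \<longrightarrow> y x = 0"
  shows "sol a q \<mu> x l = y x"
proof -
  have "(THE y. is_solution a q l y \<and> (\<forall>i\<in>{0,1}. dd i y 0 = (if \<mu> = i then 1 else 0)) \<and>
             (\<forall>x. x \<notin> {0..pi} \<longrightarrow> y x = 0)) = y"
  proof (rule the_equality)
    fix z assume z: "is_solution a q l z \<and> (\<forall>i\<in>{0,1}. dd i z 0 = (if \<mu> = i then 1 else 0)) \<and>
             (\<forall>x. x \<notin> {0..pi} \<longrightarrow> z x = 0)"
    show "z = y"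
      by (rule is_solution_unique[OF a _ y]) (use z init out in \<open>auto simp: dd_simps\<close>)
  qed (use assms in auto)
  then show ?thesis by (simp add: sol_def)
qed

section \<open>Solving the delay equation by the Duhamel formula\<close>

definition free_sol :: "nat \<Rightarrow> complex \<Rightarrow> real \<Rightarrow> complex" where
  "free_sol \<mu> l = (if \<mu> = 0 then cs l else sn l)"

definition free_sol' :: "nat \<Rightarrow> complex \<Rightarrow> real \<Rightarrow> complex" where
  "free_sol' \<mu> l x = (if \<mu> = 0 then - l * sn l x else cs l x)"

lemma free_sol_deriv: "(free_sol \<mu> l has_vector_derivative free_sol' \<mu> l x) (at x within T)"
  by (simp add: free_sol_def free_sol'_def has_vector_derivative_cs[simplified] has_vector_derivative_sn)

lemma free_sol'_deriv: "(free_sol' \<mu> l has_vector_derivative - l * free_sol \<mu> l x) (at x within T)"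
  unfolding free_sol'_def[abs_def] free_sol_def
  using has_vector_derivative_mult_right[OF has_vector_derivative_sn, of "-l" l x T] has_vector_derivative_cs[of l x T]
  by auto

lemma free_sol_0: "free_sol 0 l 0 = 1" "free_sol (Suc 0) l 0 = 0" "free_sol' 0 l 0 = 0" "free_sol' (Suc 0) l 0 = 1"
  by (auto simp: free_sol_def free_sol'_def)

lemma continuous_on_free_sol [continuous_intros]: "continuous_on T g \<Longrightarrow> continuous_on T (\<lambda>x. free_sol \<mu> l (g x))"
  unfolding free_sol_def by (auto intro: continuous_intros)

text \<open>The delay equation becomes the self-consistency condition \<open>eq\<close> for the
  forcing term. Once a forcing term meets it, \<open>Y\<close> is a solution with the right initial
  data, and uniqueness identifies it with \<open>sol\<close>; the extension by zero is the one in
  \<open>sol\<close>.\<close>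

lemma sol_duhamel:
  assumes a: "a > 0" and r: "piecewise_cont N r" and N: "finite N" and \<mu>: "\<mu> \<in> {0,1}"
    and Y: "\<And>x. Y x = (if x \<in> {0..pi} then free_sol \<mu> l x + duhamel l r x else 0)"
    and eq: "\<And>x. x \<in> {0<..<pi} - N \<Longrightarrow> r x = q x * Y (x - a)"
  shows "sol a q \<mu> x l = Y x" "dd 1 Y pi = free_sol' \<mu> l pi + duhamel' l r pi"
proof -
  have Yd: "(Y has_vector_derivative free_sol' \<mu> l x + duhamel' l r x) (at x within {0..pi})" if x: "x \<in> {0..pi}" for x
    by (rule has_vector_derivative_transform[OF x _ has_vector_derivative_add[OF free_sol_deriv duhamel_deriv[OF r x]]])
       (simp add: Y)
  have dY: "dd 1 Y x = free_sol' \<mu> l x + duhamel' l r x" if x: "x \<in> {0..pi}" for x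
    using vector_derivative_within_closed_interval[OF pi_gt_zero x Yd[OF x]] by (simp add: dd_simps)
  show "dd 1 Y pi = free_sol' \<mu> l pi + duhamel' l r pi" by (rule dY) simp
  obtain L where L: "\<And>x y. x \<in> {0..pi} \<Longrightarrow> y \<in> {0..pi} \<Longrightarrow> norm (duhamel' l r x - duhamel' l r y) \<le> L * \<bar>x - y\<bar>"
    using duhamel'_lipschitz[OF r] by blast
  have "continuous_on {0..pi} (\<lambda>x. - l * free_sol \<mu> l x)" by (intro continuous_intros)
  then obtain K where K: "\<And>x. x \<in> {0..pi} \<Longrightarrow> norm (- l * free_sol \<mu> l x) \<le> K"
    using continuous_on_Icc_bounded by blast
  have "((\<lambda>x. - l * free_sol \<mu> l x) has_integral free_sol' \<mu> l v - free_sol' \<mu> l u) {u..v}" if "u \<le> v" for u v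
    by (rule fundamental_theorem_of_calculus[OF that]) (rule free_sol'_deriv)
  then have K': "\<And>x y. x \<in> {0..pi} \<Longrightarrow> y \<in> {0..pi} \<Longrightarrow> norm (free_sol' \<mu> l x - free_sol' \<mu> l y) \<le> \<bar>K\<bar> * \<bar>x - y\<bar>"
    by (intro has_integral_imp_lipschitz[where f' = "\<lambda>x. - l * free_sol \<mu> l x" and a = 0 and b = pi] K)
  have ac: "abs_continuous_on {0..pi} (dd 1 Y)"
  proof (rule abs_continuous_on_lipschitz[where L="\<bar>K\<bar> + L"])
    fix x y assume xy: "x \<in> {0..pi}" "y \<in> {0..pi}"
    show "norm (dd 1 Y x - dd 1 Y y) \<le> (\<bar>K\<bar> + L) * \<bar>x - y\<bar>"
      unfolding dY[OF xy(1)] dY[OF xy(2)]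
      using norm_triangle_ineq[of "free_sol' \<mu> l x - free_sol' \<mu> l y" "duhamel' l r x - duhamel' l r y"] L[OF xy] K'[OF xy]
      by (simp add: algebra_simps)
  qed
  have "AE x in lebesgue_on {0<..<pi}. \<exists>y2. (dd 1 Y has_vector_derivative y2) (at x) \<and>
             - y2 + q x * Y (x - a) = l * Y x"
  proof (subst AE_lebesgue_on_negligible, simp, intro exI conjI ballI)
    show "negligible N" using N by (rule negligible_finite)
    fix x assume x: "x \<in> {0<..<pi} - N"
    have "((\<lambda>x. free_sol' \<mu> l x + duhamel' l r x) has_vector_derivative - l * free_sol \<mu> l x + (r x - l * duhamel l r x)) (at x)"
      using x by (intro has_vector_derivative_add free_sol'_deriv duhamel_derivs_interior[OF r]) auto
    then show "(dd 1 Y has_vector_derivative - l * free_sol \<mu> l x + (r x - l * duhamel l r x)) (at x)"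
      by (rule has_vector_derivative_transform_within_open[where S="{0<..<pi}"]) (use x dY in auto)
    show "- (- l * free_sol \<mu> l x + (r x - l * duhamel l r x)) + q x * Y (x - a) = l * Y x"
      using x eq[OF x] by (auto simp: Y[of x] algebra_simps)
  qed
  then have "is_solution a q l Y"
    unfolding is_solution_def using differentiableI_vector[OF Yd] ac by blast
  moreover have "\<forall>i\<in>{0,1}. dd i Y 0 = (if \<mu> = i then 1 else 0)"
    using \<mu> dY[of 0] by (auto simp: dd_simps Y free_sol_0)
  ultimately show "sol a q \<mu> x l = Y x"
    using sol_eq[OF a] Y by auto
qed

subsection \<open>The integral identity behind the cancellation\<close>

text \<open>Fubini for \<open>g\<close> times the indicator of the compact triangle
  \<open>T\<close>, on which the continuous \<open>g\<close> is integrable; integrability of the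
  inner integral comes along.\<close>

lemma integral_triangle_swap:
  fixes g :: "real \<Rightarrow> real \<Rightarrow> complex"
  assumes g: "continuous_on UNIV (\<lambda>p. g (fst p) (snd p))"
  shows "integral {0..L} (\<lambda>x. integral {0..x} (\<lambda>y. g x y)) = integral {0..L} (\<lambda>y. integral {y..L} (\<lambda>x. g x y))"
    and "(\<lambda>x. integral {0..x} (\<lambda>y. g x y)) integrable_on {0..L}"
proof -
  define T where "T = {p :: real \<times> real. 0 \<le> snd p \<and> snd p \<le> fst p \<and> fst p \<le> L}"
  have "closed T" unfolding T_def
    by (intro closed_Collect_conj closed_Collect_le continuous_intros)
  moreover have "T \<subseteq> {0..L} \<times> {0..L}" unfolding T_def by auto
  then have "bounded T" by (rule bounded_subset[rotated]) (intro bounded_Times bounded_closed_interval)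
  ultimately have "compact T" by (simp add: compact_eq_bounded_closed)
  have "integrable lborel (\<lambda>p. indicator T p *\<^sub>R g (fst p) (snd p))"
    by (rule borel_integrable_compact[OF \<open>compact T\<close>]) (rule continuous_on_subset[OF g], simp)
  then have int: "integrable (lborel \<Otimes>\<^sub>M lborel) (\<lambda>(x,y). indicator T (x,y) *\<^sub>R g x y)"
    by (simp add: lborel_prod split_def)
  have gx: "continuous_on S (\<lambda>y. g x y)" for x S
    using continuous_on_compose2[OF g, of S "\<lambda>y. (x,y)"] by (simp add: continuous_on_Pair)
  have gy: "continuous_on S (\<lambda>x. g x y)" for y S
    using continuous_on_compose2[OF g, of S "\<lambda>x. (x,y)"] by (simp add: continuous_on_Pair)
  have lint: "(\<integral>y. indicator {u..v} y *\<^sub>R k y \<partial>lborel) = integral {u..v} k"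
    if "continuous_on {u..v} k" for u v :: real and k :: "real \<Rightarrow> complex"
    using set_borel_integral_eq_integral(2)[of "{u..v}" k] borel_integrable_atLeastAtMost'[OF that]
    by (simp add: set_lebesgue_integral_def)
  have setlint: "(\<integral>x. indicator {0..L} x *\<^sub>R k x \<partial>lborel) = integral {0..L} k"
    if "integrable lborel (\<lambda>x. indicator {0..L} x *\<^sub>R k x)" for k :: "real \<Rightarrow> complex"
    using set_borel_integral_eq_integral(2)[of "{0..L}" k] that
    by (simp add: set_lebesgue_integral_def set_integrable_def)
  have i1: "(\<integral>y. indicator T (x,y) *\<^sub>R g x y \<partial>lborel) = indicator {0..L} x *\<^sub>R integral {0..x} (\<lambda>y. g x y)" for x
  proof -
    have "(\<integral>y. indicator T (x,y) *\<^sub>R g x y \<partial>lborel) = (\<integral>y. indicator {0..L} x *\<^sub>R (indicator {0..x} y *\<^sub>R g x y) \<partial>lborel)"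
      by (intro Bochner_Integration.integral_cong) (auto simp: T_def indicator_def)
    then show ?thesis by (simp only: Bochner_Integration.integral_scaleR_right lint[OF gx])
  qed
  have i2: "(\<integral>x. indicator T (x,y) *\<^sub>R g x y \<partial>lborel) = indicator {0..L} y *\<^sub>R integral {y..L} (\<lambda>x. g x y)" for y
  proof -
    have "(\<integral>x. indicator T (x,y) *\<^sub>R g x y \<partial>lborel) = (\<integral>x. indicator {0..L} y *\<^sub>R (indicator {y..L} x *\<^sub>R g x y) \<partial>lborel)"
      by (intro Bochner_Integration.integral_cong) (auto simp: T_def indicator_def)
    then show ?thesis by (simp only: Bochner_Integration.integral_scaleR_right lint[OF gy])
  qed
  have "(\<integral>y. (\<integral>x. indicator T (x,y) *\<^sub>R g x y \<partial>lborel) \<partial>lborel) = (\<integral>x. (\<integral>y. indicator T (x,y) *\<^sub>R g x y \<partial>lborel) \<partial>lborel)"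
    by (rule lborel_pair.Fubini_integral[OF int])
  moreover have "integrable lborel (\<lambda>x. indicator {0..L} x *\<^sub>R integral {0..x} (\<lambda>y. g x y))"
    using lborel_pair.integrable_fst[OF int] by (simp add: i1)
  moreover have "integrable lborel (\<lambda>y. indicator {0..L} y *\<^sub>R integral {y..L} (\<lambda>x. g x y))"
    using lborel_pair.integrable_snd[OF int] by (simp add: i2)
  ultimately show "integral {0..L} (\<lambda>x. integral {0..x} (\<lambda>y. g x y)) = integral {0..L} (\<lambda>y. integral {y..L} (\<lambda>x. g x y))"
    and "(\<lambda>x. integral {0..x} (\<lambda>y. g x y)) integrable_on {0..L}"
    using set_borel_integral_eq_integral(1)[of "{0..L}" "\<lambda>x. integral {0..x} (\<lambda>y. g x y)"]
    by (simp_all add: i1 i2 setlint set_integrable_def)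
qed

lemma integral_reflect_interval:
  fixes g :: "real \<Rightarrow> complex"
  shows "integral {0..b} (\<lambda>x. g (b - x)) = integral {0..b} g"
proof -
  have "integral {0..b} (\<lambda>x. g (b - x)) = integral {-b..0} (\<lambda>x. g (b + x))"
    using Henstock_Kurzweil_Integration.integral_reflect_real[of b 0 "\<lambda>x. g (b - x)"] by simp
  also have "\<dots> = integral {0..b} g"
    using integral_shift_Icc_real[of "-b" 0 g b] by (simp add: o_def)
  finally show ?thesis .
qed

text \<open>Here \<open>\<phi>\<close> and \<open>y0\<close> stand for free solutions. By
  \<open>prod\<close> each integrand splits into a part in \<open>A + B\<close> and a part in
  \<open>A - B\<close>. In the first two integrals \<open>A - B = a\<close> is constant, so that
  part is a multiple of \<open>F L\<close> or of the integral of \<open>F * H\<close>, both 0. Twice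
  the three integrals are then \<open>I1\<close>, \<open>- I2\<close> and
  \<open>I2 - I1\<close>.\<close>

lemma three_term_identity:
  fixes f F H \<phi> y0 \<Psi> :: "real \<Rightarrow> complex"
  assumes cont: "continuous_on UNIV f" "continuous_on UNIV H" "continuous_on UNIV \<Psi>" "continuous_on UNIV F"
    and prod: "\<And>A B. 2 * (\<phi> A * y0 B) = \<Psi> (A + B) + \<sigma> * \<Psi> (A - B)"
    and F: "\<And>x. 0 \<le> x \<Longrightarrow> integral {0..x} f = F x"
    and FL: "F L = 0" and FH: "integral {0..L} (\<lambda>x. F x * H x) = 0"
    and eigen: "\<And>x. x \<in> {0..L} \<Longrightarrow> \<sigma> * integral {x..L} (\<lambda>t. H t * f (t - x)) = - f x"
    and L: "L > 0"
  shows "integral {0..L} (\<lambda>x. \<phi> (3*a/2 + x) * (f x * y0 (a/2 + x)))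
       + integral {0..L} (\<lambda>x. \<phi> (2*a + x) * (- (F x * H x) * y0 (a + x)))
       + integral {0..L} (\<lambda>t. H t * integral {0..t} (\<lambda>x. \<phi> (5*a/2 + 2*t - x) * (f x * y0 (a/2 + x)))) = 0"
proof -
  note [continuous_intros] = continuous_on_compose2[OF cont(1)] continuous_on_compose2[OF cont(2)]
    continuous_on_compose2[OF cont(3)] continuous_on_compose2[OF cont(4)]
  define I1 where "I1 = integral {0..L} (\<lambda>x. f x * \<Psi> (2*a + 2*x))"
  define I2 where "I2 = integral {0..L} (\<lambda>x. F x * H x * \<Psi> (3*a + 2*x))"
  have t1: "2 * integral {0..L} (\<lambda>x. \<phi> (3*a/2 + x) * (f x * y0 (a/2 + x))) = I1"
  proof -
    have "2 * integral {0..L} (\<lambda>x. \<phi> (3*a/2 + x) * (f x * y0 (a/2 + x)))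
      = integral {0..L} (\<lambda>x. f x * (2 * (\<phi> (3*a/2 + x) * y0 (a/2 + x))))"
      by (simp add: mult_ac flip: integral_mult_right)
    also have "\<dots> = integral {0..L} (\<lambda>x. f x * \<Psi> (2*a + 2*x) + \<sigma> * \<Psi> a * f x)"
      unfolding prod by (intro integral_cong) (simp add: algebra_simps)
    also have "\<dots> = I1 + \<sigma> * \<Psi> a * integral {0..L} f"
      unfolding I1_def by (subst integral_add) (auto intro!: integrable_continuous_real continuous_intros)
    finally show ?thesis using F[of L] FL L by simp
  qed
  have t2: "2 * integral {0..L} (\<lambda>x. \<phi> (2*a + x) * (- (F x * H x) * y0 (a + x))) = - I2"
  proof -
    have "2 * integral {0..L} (\<lambda>x. \<phi> (2*a + x) * (- (F x * H x) * y0 (a + x)))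
      = integral {0..L} (\<lambda>x. - (F x * H x * (2 * (\<phi> (2*a + x) * y0 (a + x)))))"
      by (simp add: mult_ac flip: integral_mult_right)
    also have "\<dots> = integral {0..L} (\<lambda>x. - (F x * H x * \<Psi> (3*a + 2*x)) + - \<sigma> * \<Psi> a * (F x * H x))"
      unfolding prod by (intro integral_cong) (simp add: algebra_simps)
    also have "\<dots> = - I2 + - \<sigma> * \<Psi> a * integral {0..L} (\<lambda>x. F x * H x)"
      unfolding I2_def by (subst integral_add) (auto intro!: integrable_continuous_real continuous_intros)
    finally show ?thesis using FH by simp
  qed
  \<comment> \<open>Now \<open>A + B = 3*a + 2*t\<close> is constant in \<open>x\<close>, so
    \<open>f\<close> integrates to \<open>F t\<close>. In the other part
    \<open>A - B = 2*a + 2*(t - x)\<close>, and reflecting \<open>x\<close> to \<open>t - x\<close>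
    moves the difference into \<open>f\<close>.\<close>
  have U: "2 * integral {0..t} (\<lambda>x. \<phi> (5*a/2 + 2*t - x) * (f x * y0 (a/2 + x)))
     = F t * \<Psi> (3*a + 2*t) + \<sigma> * integral {0..t} (\<lambda>x. f (t - x) * \<Psi> (2*a + 2*x))" if t: "0 \<le> t" for t
  proof -
    have "2 * integral {0..t} (\<lambda>x. \<phi> (5*a/2 + 2*t - x) * (f x * y0 (a/2 + x)))
      = integral {0..t} (\<lambda>x. f x * (2 * (\<phi> (5*a/2 + 2*t - x) * y0 (a/2 + x))))"
      by (simp add: mult_ac flip: integral_mult_right)
    also have "\<dots> = integral {0..t} (\<lambda>x. \<Psi> (3*a + 2*t) * f x + \<sigma> * (f (t - (t - x)) * \<Psi> (2*a + 2*(t - x))))"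
      unfolding prod by (intro integral_cong) (simp add: algebra_simps)
    also have "\<dots> = \<Psi> (3*a + 2*t) * integral {0..t} f + \<sigma> * integral {0..t} (\<lambda>x. f (t - (t - x)) * \<Psi> (2*a + 2*(t - x)))"
      by (subst integral_add) (auto intro!: integrable_continuous_real continuous_intros)
    also have "integral {0..t} (\<lambda>x. f (t - (t - x)) * \<Psi> (2*a + 2*(t - x))) = integral {0..t} (\<lambda>x. f (t - x) * \<Psi> (2*a + 2*x))"
      by (rule integral_reflect_interval[of t "\<lambda>x. f (t - x) * \<Psi> (2*a + 2*x)"])
    finally show ?thesis using F[OF t] by simp
  qed
  have cW: "continuous_on UNIV (\<lambda>p. H (fst p) * (f (fst p - snd p) * \<Psi> (2*a + 2 * snd p)))"
    by (auto intro!: continuous_intros)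
  have Wi: "(\<lambda>t. H t * integral {0..t} (\<lambda>x. f (t - x) * \<Psi> (2*a + 2*x))) integrable_on {0..L}"
    using integral_triangle_swap(2)[OF cW] by simp
  \<comment> \<open>The part with \<open>F t\<close> gives \<open>I2\<close>. In the rest,
    interchanging the integrations produces the Hankel-type operator applied to \<open>f\<close>,
    which \<open>eigen\<close> replaces by \<open>- f\<close>.\<close>
  have t3: "2 * integral {0..L} (\<lambda>t. H t * integral {0..t} (\<lambda>x. \<phi> (5*a/2 + 2*t - x) * (f x * y0 (a/2 + x)))) = I2 - I1"
  proof -
    have "2 * integral {0..L} (\<lambda>t. H t * integral {0..t} (\<lambda>x. \<phi> (5*a/2 + 2*t - x) * (f x * y0 (a/2 + x))))
      = integral {0..L} (\<lambda>t. H t * (2 * integral {0..t} (\<lambda>x. \<phi> (5*a/2 + 2*t - x) * (f x * y0 (a/2 + x)))))"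
      by (simp add: mult_ac flip: integral_mult_right)
    also have "\<dots> = integral {0..L} (\<lambda>t. F t * H t * \<Psi> (3*a + 2*t) + \<sigma> * (H t * integral {0..t} (\<lambda>x. f (t - x) * \<Psi> (2*a + 2*x))))"
      by (intro integral_cong, subst U) (simp_all add: algebra_simps)
    also have "\<dots> = I2 + \<sigma> * integral {0..L} (\<lambda>t. H t * integral {0..t} (\<lambda>x. f (t - x) * \<Psi> (2*a + 2*x)))"
      unfolding I2_def by (subst integral_add) (auto intro!: integrable_continuous_real integrable_on_mult_right Wi continuous_intros)
    also have "integral {0..L} (\<lambda>t. H t * integral {0..t} (\<lambda>x. f (t - x) * \<Psi> (2*a + 2*x)))
      = integral {0..L} (\<lambda>t. integral {0..t} (\<lambda>x. H t * (f (t - x) * \<Psi> (2*a + 2*x))))"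
      by simp
    also have "\<dots> = integral {0..L} (\<lambda>x. integral {x..L} (\<lambda>t. H t * (f (t - x) * \<Psi> (2*a + 2*x))))"
      by (rule integral_triangle_swap(1)[OF cW])
    also have "\<sigma> * \<dots> = integral {0..L} (\<lambda>x. \<Psi> (2*a + 2*x) * (\<sigma> * integral {x..L} (\<lambda>t. H t * f (t - x))))"
      by (simp add: mult_ac flip: integral_mult_right)
    also have "\<dots> = integral {0..L} (\<lambda>x. - (f x * \<Psi> (2*a + 2*x)))"
      by (intro integral_cong) (simp add: eigen)
    finally show ?thesis by (simp add: I1_def)
  qed
  have "X + Y + Z = 0" if "2 * X = I1" "2 * Y = - I2" "2 * Z = I2 - I1" for X Y Z :: complex
  proof -
    have "2 * (X + Y + Z) = 0" unfolding distrib_left that by simp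
    then show ?thesis unfolding mult_eq_0_iff by (rule disjE) simp_all
  qed
  from this[OF t1 t2 t3] show ?thesis .
qed

subsection \<open>The family of potentials\<close>

text \<open>The parity of \<open>free_sol \<mu> l\<close>: even for \<open>cs\<close>, odd for
  \<open>sn\<close>.\<close>

definition bc_sign :: "nat \<Rightarrow> complex" where
  "bc_sign \<mu> = (if \<mu> = 0 then 1 else - 1)"

lemma free_sol_add: "free_sol \<mu> l (x + y) = free_sol \<mu> l x * cs l y + free_sol' \<mu> l x * sn l y"
  by (auto simp: free_sol_def free_sol'_def cs_add sn_add algebra_simps)

lemma free_sol'_add: "free_sol' \<mu> l (x + y) = free_sol' \<mu> l x * cs l y - l * free_sol \<mu> l x * sn l y"
  by (auto simp: free_sol_def free_sol'_def cs_add sn_add algebra_simps)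

text \<open>The classical formulas for products of sines and cosines. One function
  \<open>\<Psi>\<close> serves both terms because replacing \<open>B\<close> by \<open>- B\<close>
  multiplies the product by the parity sign.\<close>

lemma product_to_sum:
  "\<exists>\<Psi>. continuous_on UNIV \<Psi> \<and> (\<forall>A B. 2 * (free_sol \<kappa> l A * free_sol \<mu> l B) = \<Psi> (A + B) + bc_sign \<mu> * \<Psi> (A - B))"
proof -
  have d: "cs l (A - B) = cs l A * cs l B + l * sn l A * sn l B" 
     "sn l (A - B) = sn l A * cs l B - cs l A * sn l B" for A B
    using cs_add[of l A "-B"] sn_add[of l A "-B"] by (auto simp: algebra_simps)
  consider "\<mu> = 0" | "\<mu> \<noteq> 0" "\<kappa> = 0" | "\<mu> \<noteq> 0" "\<kappa> \<noteq> 0" "l = 0" | "\<mu> \<noteq> 0" "\<kappa> \<noteq> 0" "l \<noteq> 0" by blast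
  then show ?thesis
  proof cases
    case 1
    then show ?thesis
      by (intro exI[of _ "free_sol \<kappa> l"] conjI continuous_on_free_sol continuous_on_id)
         (auto simp: free_sol_def bc_sign_def cs_add sn_add d algebra_simps)
  next
    case 2
    then show ?thesis
      by (intro exI[of _ "sn l"] conjI continuous_on_sn continuous_on_id)
         (auto simp: free_sol_def bc_sign_def cs_add sn_add d algebra_simps)
  next
    case 3
    then show ?thesis
      by (intro exI[of _ "\<lambda>x. (of_real x)\<^sup>2 / 2"] conjI continuous_intros)
         (auto simp: free_sol_def bc_sign_def sn_def power2_eq_square field_simps)
  next
    case 4
    then show ?thesis
      \<comment> \<open>The constant 1 drops out of \<open>\<Psi> (A + B) - \<Psi> (A - B)\<close>;
        with it, the limit for \<open>l\<close> tending to 0 is the quadratic function of the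
        previous case.\<close>
      by (intro exI[of _ "\<lambda>x. (1 - cs l x) / l"] conjI continuous_intros)
         (auto simp: free_sol_def bc_sign_def cs_add d field_simps)
  qed
qed

lemma duhamel_cmult: "duhamel l (\<lambda>t. c * s t) x = c * duhamel l s x"
proof -
  have "integral {0..x} (\<lambda>t. k t * (c * s t)) = c * integral {0..x} (\<lambda>t. k t * s t)" for k
    by (simp add: mult.left_commute flip: integral_mult_right)
  then show ?thesis by (simp add: duhamel_def algebra_simps)
qed

lemma duhamel_eq_0: "(\<And>t. 0 \<le> t \<Longrightarrow> t \<le> x \<Longrightarrow> r t = 0) \<Longrightarrow> duhamel l r x = 0"
  using duhamel_cong(1)[of x r "\<lambda>_. 0" l] by (simp add: duhamel_def)

text \<open>The bounds on \<open>L\<close> keep the three windows disjoint and inside the interval.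
  \<open>FL\<close> and \<open>FH\<close> remove the constant-difference parts in
  \<open>three_term_identity\<close>, \<open>HL\<close> a boundary term of the integration by parts,
  and \<open>eigen\<close> makes the remaining terms cancel.\<close>

locale iso_bispectral_family =
  fixes a L :: real and \<mu> :: nat and f F H h :: "real \<Rightarrow> complex"
  assumes L: "0 < L" "L < a / 2" and api: "5*a/2 + L < pi" and \<mu>: "\<mu> \<in> {0,1}"
    and cont: "continuous_on UNIV f" "continuous_on UNIV h"
    and F': "\<And>x. (F has_vector_derivative f x) (at x)"
    and H': "\<And>x. (H has_vector_derivative - h x) (at x)"
    and F0: "F 0 = 0" and FL: "F L = 0" and HL: "H L = 0"
    and FH: "integral {0..L} (\<lambda>x. F x * H x) = 0"
    and eigen: "\<And>x. x \<in> {0..L} \<Longrightarrow> bc_sign \<mu> * integral {x..L} (\<lambda>t. H t * f (t - x)) = - f x"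
begin

lemma a_pos: "0 < a" using L by simp

lemma cont_FH: "continuous_on UNIV F" "continuous_on UNIV H"
  using F' H' by (auto intro!: continuous_at_imp_continuous_on has_vector_derivative_continuous)

lemmas cont' [continuous_intros] = continuous_on_compose2[OF cont(1)] continuous_on_compose2[OF cont(2)]
  continuous_on_compose2[OF cont_FH(1)] continuous_on_compose2[OF cont_FH(2)]

definition e where
  "e x = window (3*a/2) (3*a/2 + L) (\<lambda>x. f (x - 3*a/2)) x + window (2*a) (2*a + L) (\<lambda>x. - (F (x - 2*a) * H (x - 2*a))) x"

definition q where
  "q c x = window (5*a/2) (5*a/2 + L) (\<lambda>x. h (x - 5*a/2)) x + c * e x"

text \<open>
  The forcing term of \<open>Y l c\<close> is affine in \<open>c\<close>: \<open>r0\<close> is its constant term and \<open>r1 = s1 + s2 + s3\<close> its slope.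
\<close>

definition s1 where "s1 l = window (3*a/2) (3*a/2 + L) (\<lambda>x. f (x - 3*a/2) * free_sol \<mu> l (x - a))"
definition s2 where "s2 l = window (2*a) (2*a + L) (\<lambda>x. - (F (x - 2*a) * H (x - 2*a)) * free_sol \<mu> l (x - a))"
definition s3 where "s3 l = window (5*a/2) (5*a/2 + L) (\<lambda>x. h (x - 5*a/2) * duhamel l (s1 l) (x - a))"
definition r0 where "r0 l = window (5*a/2) (5*a/2 + L) (\<lambda>x. h (x - 5*a/2) * free_sol \<mu> l (x - a))"
definition r1 where "r1 l x = s1 l x + s2 l x + s3 l x"
definition Y where "Y l c x = (if x \<in> {0..pi} then free_sol \<mu> l x + duhamel l (\<lambda>t. r0 l t + c * r1 l t) x else 0)"

lemma piecewise_cont_s1: "piecewise_cont {3*a/2, 3*a/2 + L} (s1 l)"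
  unfolding s1_def by (intro piecewise_cont_window continuous_intros) auto

lemma piecewise_cont_s2: "piecewise_cont {2*a, 2*a + L} (s2 l)"
  unfolding s2_def by (intro piecewise_cont_window continuous_intros) auto

lemma cont_D: "continuous_on {5*a/2..5*a/2 + L} (\<lambda>x. duhamel l (s1 l) (x - a))"
  by (rule continuous_on_compose2[OF continuous_on_duhamel(1)[OF piecewise_cont_s1, of pi]])
     (use L api a_pos in \<open>auto intro!: continuous_intros\<close>)

lemma piecewise_cont_s3: "piecewise_cont {5*a/2, 5*a/2 + L} (s3 l)"
  unfolding s3_def by (intro piecewise_cont_window continuous_intros cont_D) auto

lemma piecewise_cont_r0: "piecewise_cont {5*a/2, 5*a/2 + L} (r0 l)"
  unfolding r0_def by (intro piecewise_cont_window continuous_intros) auto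

lemma piecewise_cont_r1: "piecewise_cont ({3*a/2, 3*a/2 + L} \<union> {2*a, 2*a + L} \<union> {5*a/2, 5*a/2 + L}) (r1 l)"
  unfolding r1_def[abs_def] by (intro piecewise_cont_add piecewise_cont_s1 piecewise_cont_s2 piecewise_cont_s3)

text \<open>Shifted back by \<open>a\<close>, the window of \<open>h\<close> becomes
  \<open>{3*a/2..3*a/2 + L}\<close>, where the Duhamel integral has met only \<open>s1\<close>, as
  \<open>3*a/2 + L < 2*a\<close>. The two windows of \<open>e\<close> end up left of
  \<open>3*a/2\<close>, where \<open>Y\<close> is still the free solution.\<close>

lemma Y_delay:
  assumes x: "x \<in> {0<..<pi}"
  shows "r0 l x + c * r1 l x = q c x * Y l c (x - a)"
proof -
  consider "x \<in> {5*a/2..5*a/2 + L}" | "x \<in> {3*a/2..3*a/2 + L} \<union> {2*a..2*a + L}"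
    | "x \<notin> {5*a/2..5*a/2 + L} \<union> {3*a/2..3*a/2 + L} \<union> {2*a..2*a + L}" by blast
  then show ?thesis
  proof cases
    case 1
    have "duhamel l (\<lambda>t. r0 l t + c * r1 l t) (x - a) = duhamel l (\<lambda>t. c * s1 l t) (x - a)"
      by (rule duhamel_cong) (use 1 L in \<open>auto simp: r0_def r1_def s2_def s3_def window_def\<close>)
    then have "Y l c (x - a) = free_sol \<mu> l (x - a) + c * duhamel l (s1 l) (x - a)"
      using 1 L a_pos api by (auto simp: Y_def duhamel_cmult)
    moreover have "e x = 0" "s1 l x = 0" "s2 l x = 0" using 1 L by (auto simp: e_def s1_def s2_def window_def)
    ultimately show ?thesis using 1 by (simp add: q_def r0_def r1_def s3_def window_def algebra_simps)
  next
    case 2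
    have "duhamel l (\<lambda>t. r0 l t + c * r1 l t) (x - a) = 0"
      by (rule duhamel_eq_0) (use 2 L in \<open>auto simp: r0_def r1_def s1_def s2_def s3_def window_def\<close>)
    then have Y: "Y l c (x - a) = free_sol \<mu> l (x - a)"
      using 2 L a_pos api by (auto simp: Y_def)
    have "r0 l x = 0" "s3 l x = 0" using 2 L by (auto simp: r0_def s3_def window_def)
    moreover have "window (5*a/2) (5*a/2 + L) (\<lambda>x. h (x - 5*a/2)) x = 0" using 2 L by (auto simp: window_def)
    ultimately show ?thesis unfolding Y by (simp add: q_def e_def r1_def s1_def s2_def window_def algebra_simps)
  next
    case 3
    then show ?thesis by (auto simp: r0_def r1_def s1_def s2_def s3_def q_def e_def window_def)
  qed
qed

section \<open>Orthogonality of the slope of the forcing term to the free solutions\<close>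

text \<open>The left side is the derivative of the product of \<open>free_sol\<close> and
  \<open>duhamel\<close> in their common shift \<open>t\<close>. Under the integral, differentiating
  \<open>free_sol \<kappa> l X * sn l (x - t)\<close> in \<open>X\<close> and \<open>x\<close>
  simultaneously gives, by the addition formula, the single factor
  \<open>free_sol \<kappa> l (X + x - t)\<close>.\<close>

lemma free_mult_D:
  assumes t: "t \<in> {0..L}"
  shows "free_sol' \<kappa> l (5*a/2 + t) * duhamel l (s1 l) (3*a/2 + t) + free_sol \<kappa> l (5*a/2 + t) * duhamel' l (s1 l) (3*a/2 + t)
     = integral {0..t} (\<lambda>x. free_sol \<kappa> l (5*a/2 + 2*t - x) * (f x * free_sol \<mu> l (a/2 + x)))"
proof -
  define X where "X = 5*a/2 + t"
  define x where "x = 3*a/2 + t"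
  define A where "A = integral {0..x} (\<lambda>t. cs l t * s1 l t)"
  define B where "B = integral {0..x} (\<lambda>t. sn l t * s1 l t)"
  have iA: "(\<lambda>t. cs l t * s1 l t) integrable_on {0..x}" and iB: "(\<lambda>t. sn l t * s1 l t) integrable_on {0..x}"
    by (intro piecewise_cont_integrable[OF piecewise_cont_s1] continuous_intros)+
  have "free_sol' \<kappa> l X * duhamel l (s1 l) x + free_sol \<kappa> l X * duhamel' l (s1 l) x = free_sol \<kappa> l (X + x) * A - free_sol' \<kappa> l (X + x) * B"
    by (simp add: duhamel_def duhamel'_def A_def B_def free_sol_add free_sol'_add algebra_simps)
  also have "\<dots> = integral {0..x} (\<lambda>t. free_sol \<kappa> l (X + x) * (cs l t * s1 l t) - free_sol' \<kappa> l (X + x) * (sn l t * s1 l t))"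
    unfolding A_def B_def
    by (subst integral_diff) (use iA iB in \<open>auto intro: integrable_on_mult_right\<close>)
  also have "\<dots> = integral {0..x} (\<lambda>t. free_sol \<kappa> l (X + x - t) * s1 l t)"
  proof (intro integral_cong)
    fix t
    show "free_sol \<kappa> l (X + x) * (cs l t * s1 l t) - free_sol' \<kappa> l (X + x) * (sn l t * s1 l t) = free_sol \<kappa> l (X + x - t) * s1 l t"
      using arg_cong[OF free_sol_add[of \<kappa> l "X + x" "-t"], of "\<lambda>z. z * s1 l t"] by (simp add: algebra_simps)
  qed
  also have "\<dots> = integral {3*a/2..min (3*a/2 + L) x} (\<lambda>t. free_sol \<kappa> l (X + x - t) * (f (t - 3*a/2) * free_sol \<mu> l (t - a)))"
    unfolding s1_def by (rule integral_mult_window) (use a_pos in simp)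
  also have "\<dots> = integral {0 + 3*a/2..t + 3*a/2} (\<lambda>t. free_sol \<kappa> l (X + x - t) * (f (t - 3*a/2) * free_sol \<mu> l (t - a)))"
    using t by (simp add: x_def add.commute)
  also have "\<dots> = integral {0..t} ((\<lambda>t. free_sol \<kappa> l (X + x - t) * (f (t - 3*a/2) * free_sol \<mu> l (t - a))) \<circ> (+) (3*a/2))"
    by (rule integral_shift_Icc_real[symmetric])
  also have "\<dots> = integral {0..t} (\<lambda>x. free_sol \<kappa> l (5*a/2 + 2*t - x) * (f x * free_sol \<mu> l (a/2 + x)))"
    by (intro integral_cong) (simp add: X_def x_def algebra_simps)
  finally show ?thesis by (simp add: X_def x_def)
qed

lemma integral_mult_window_shift:
  assumes "0 \<le> b" "b + L \<le> pi"
  shows "integral {0..pi} (\<lambda>t. k t * window b (b + L) g t) = integral {0..L} (\<lambda>x. k (b + x) * g (b + x))"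
proof -
  have "integral {0..pi} (\<lambda>t. k t * window b (b + L) g t) = integral {0 + b..L + b} (\<lambda>t. k t * g t)"
    using integral_mult_window[OF assms(1), of pi k "b + L" g] assms by (simp add: add.commute)
  also have "\<dots> = integral {0..L} ((\<lambda>t. k t * g t) \<circ> (+) b)"
    by (rule integral_shift_Icc_real[symmetric])
  finally show ?thesis by (simp add: o_def)
qed

text \<open>Integration by parts with \<open>H' = - h\<close>: the derivative moves to the product
  \<open>V\<close> of the test function and the response \<open>D\<close>, where
  \<open>free_mult_D\<close> evaluates it. The boundary terms vanish by \<open>H L = 0\<close> and
  \<open>D 0 = 0\<close>.\<close>

lemma integral_s3:
  "integral {0..pi} (\<lambda>x. free_sol \<kappa> l x * s3 l x) 
    = integral {0..L} (\<lambda>t. H t * integral {0..t} (\<lambda>x. free_sol \<kappa> l (5*a/2 + 2*t - x) * (f x * free_sol \<mu> l (a/2 + x))))"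
proof -
  define D where "D t = duhamel l (s1 l) (3*a/2 + t)" for t
  define D' where "D' t = duhamel' l (s1 l) (3*a/2 + t)" for t
  define V where "V t = free_sol \<kappa> l (5*a/2 + t) * D t" for t
  define V' where "V' t = free_sol \<kappa> l (5*a/2 + t) * D' t + free_sol' \<kappa> l (5*a/2 + t) * D t" for t
  have cD: "continuous_on {0..L} D" "continuous_on {0..L} D'"
    unfolding D_def[abs_def] D'_def[abs_def]
    by (rule continuous_on_compose2[OF continuous_on_duhamel(1)[OF piecewise_cont_s1, of pi]] continuous_on_compose2[OF continuous_on_duhamel(2)[OF piecewise_cont_s1, of pi]],
      use L api a_pos in \<open>auto intro!: continuous_intros\<close>)+
  have cfree': "continuous_on S (\<lambda>t. free_sol' \<kappa> l (5*a/2 + t))" for S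
    unfolding free_sol'_def by (cases "\<kappa> = 0") (auto intro!: continuous_intros)
  have cV: "continuous_on {0..L} V" "continuous_on {0..L} V'"
    unfolding V_def[abs_def] V'_def[abs_def] by (intro continuous_intros cD cfree')+
  have V: "(V has_vector_derivative V' t) (at t)" if t: "t \<in> {0<..<L}" for t
  proof -
    have "((+) (3*a/2) has_vector_derivative 1) (at t)" "((+) (5*a/2) has_vector_derivative 1) (at t)"
      by (auto intro!: derivative_eq_intros)
    moreover have "(duhamel l (s1 l) has_vector_derivative D' t) (at (3*a/2 + t))"
      unfolding D'_def by (rule duhamel_derivs_interior[OF piecewise_cont_s1]) (use t a_pos in auto)
    ultimately have "(D has_vector_derivative D' t) (at t)"
      "((\<lambda>t. free_sol \<kappa> l (5*a/2 + t)) has_vector_derivative free_sol' \<kappa> l (5*a/2 + t)) (at t)"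
      using vector_diff_chain_at[of "(+) (3*a/2)" 1 t "duhamel l (s1 l)" "D' t"]
        vector_diff_chain_at[of "(+) (5*a/2)" 1 t "free_sol \<kappa> l", OF _ free_sol_deriv]
      by (auto simp: D_def[abs_def] o_def)
    then show ?thesis unfolding V_def[abs_def] V'_def
      by (rule has_vector_derivative_mult[rotated])
  qed
  \<comment> \<open>At \<open>3*a/2\<close> the forcing \<open>s1\<close> only sets in: the integral
    runs over a single point.\<close>
  have D0: "D 0 = 0"
    unfolding D_def
  proof -
    have "integral {0..3*a/2} (\<lambda>t. k t * s1 l t) = 0" for k
      unfolding s1_def using integral_mult_window[of "3*a/2" "3*a/2" k] a_pos L by simp
    then show "duhamel l (s1 l) (3*a/2 + 0) = 0" by (simp add: duhamel_def)
  qed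
  have "((\<lambda>t. H t * V' t + - h t * V t) has_integral H L * V L - H 0 * V 0) {0..L}"
  proof (rule fundamental_theorem_of_calculus_interior_strong[where S="{}"])
    show "continuous_on {0..L} (\<lambda>t. H t * V t)" by (intro continuous_intros cV) auto
    show "((\<lambda>t. H t * V t) has_vector_derivative H t * V' t + - h t * V t) (at t)" if "t \<in> {0<..<L} - {}" for t
      using has_vector_derivative_mult[OF H' V] that by simp
  qed (use L in auto)
  then have "integral {0..L} (\<lambda>t. H t * V' t - h t * V t) = 0"
    using HL D0 by (simp add: V_def integral_unique)
  moreover have "integral {0..L} (\<lambda>t. H t * V' t - h t * V t) = integral {0..L} (\<lambda>t. H t * V' t) - integral {0..L} (\<lambda>t. h t * V t)"
    by (intro integral_diff integrable_continuous_real continuous_intros cV) auto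
  ultimately have "integral {0..L} (\<lambda>t. h t * V t) = integral {0..L} (\<lambda>t. H t * V' t)" by simp
  moreover have "integral {0..pi} (\<lambda>x. free_sol \<kappa> l x * s3 l x) = integral {0..L} (\<lambda>t. h t * V t)"
    unfolding s3_def
    by (subst integral_mult_window_shift) (use a_pos api in \<open>auto simp: V_def D_def algebra_simps intro!: integral_cong\<close>)
  moreover have "integral {0..L} (\<lambda>t. H t * V' t) = integral {0..L} (\<lambda>t. H t * integral {0..t} (\<lambda>x. free_sol \<kappa> l (5*a/2 + 2*t - x) * (f x * free_sol \<mu> l (a/2 + x))))"
    by (intro integral_cong, subst free_mult_D[symmetric]) (auto simp: V'_def D_def D'_def algebra_simps)
  ultimately show ?thesis by simp
qed

lemma integral_r1: "integral {0..pi} (\<lambda>x. free_sol \<kappa> l x * r1 l x) = 0"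
proof -
  obtain \<Psi> where \<Psi>: "continuous_on UNIV \<Psi>" "\<And>A B. 2 * (free_sol \<kappa> l A * free_sol \<mu> l B) = \<Psi> (A + B) + bc_sign \<mu> * \<Psi> (A - B)"
    using product_to_sum[of \<kappa> l \<mu>] by blast
  have F: "integral {0..x} f = F x" if "0 \<le> x" for x
    using fundamental_theorem_of_calculus[OF that, of F f] F' F0
    by (simp add: has_vector_derivative_at_within integral_unique)
  have i1: "integral {0..pi} (\<lambda>x. free_sol \<kappa> l x * s1 l x) = integral {0..L} (\<lambda>x. free_sol \<kappa> l (3*a/2 + x) * (f x * free_sol \<mu> l (a/2 + x)))"
    unfolding s1_def by (subst integral_mult_window_shift) (use a_pos api in \<open>auto simp: algebra_simps intro!: integral_cong\<close>)
  have i2: "integral {0..pi} (\<lambda>x. free_sol \<kappa> l x * s2 l x) = integral {0..L} (\<lambda>x. free_sol \<kappa> l (2*a + x) * (- (F x * H x) * free_sol \<mu> l (a + x)))"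
    unfolding s2_def by (subst integral_mult_window_shift) (use a_pos api in \<open>auto simp: algebra_simps intro!: integral_cong\<close>)
  have "integral {0..pi} (\<lambda>x. free_sol \<kappa> l x * r1 l x) = integral {0..pi} (\<lambda>x. free_sol \<kappa> l x * s1 l x + free_sol \<kappa> l x * s2 l x + free_sol \<kappa> l x * s3 l x)"
    by (simp add: r1_def distrib_left)
  also have "\<dots> = integral {0..pi} (\<lambda>x. free_sol \<kappa> l x * s1 l x) + integral {0..pi} (\<lambda>x. free_sol \<kappa> l x * s2 l x) + integral {0..pi} (\<lambda>x. free_sol \<kappa> l x * s3 l x)"
    using piecewise_cont_integrable[OF piecewise_cont_s1 continuous_on_free_sol] piecewise_cont_integrable[OF piecewise_cont_s2 continuous_on_free_sol] piecewise_cont_integrable[OF piecewise_cont_s3 continuous_on_free_sol]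
    by (subst integral_add; (subst integral_add)?) (auto intro!: integrable_add)
  also have "\<dots> = 0"
    unfolding i1 i2 integral_s3
    by (rule three_term_identity[OF cont(1) cont_FH(2) \<Psi>(1) cont_FH(1) \<Psi>(2) F FL FH eigen L(1)])
  finally show ?thesis .
qed

text \<open>At \<open>pi\<close> both Duhamel expressions are combinations of the integrals of
  \<open>r1\<close> against \<open>cs\<close> and \<open>sn\<close>, the cases
  \<open>\<kappa> = 0\<close> and \<open>\<kappa> = 1\<close> of the orthogonality relation.\<close>

lemma duhamel_r1: "duhamel l (r1 l) pi = 0" "duhamel' l (r1 l) pi = 0"
  using integral_r1[of 0 l] integral_r1[of 1 l] by (simp_all add: duhamel_def duhamel'_def free_sol_def)

text \<open>The right side is free of \<open>c\<close>: the solution depends on \<open>c\<close>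
  through \<open>c\<close> times the response to \<open>r1\<close>, which vanishes at
  \<open>pi\<close> together with its derivative.\<close>

lemma char_fun_q:
  assumes "\<nu> \<in> {0,1}" "\<mu> = 1 - \<nu>" "j \<in> {0,1}"
  shows "char_fun \<nu> j a (q c) l = (if j = 0 then free_sol \<mu> l pi + duhamel l (r0 l) pi else free_sol' \<mu> l pi + duhamel' l (r0 l) pi)"
proof -
  have R: "piecewise_cont ({5*a/2, 5*a/2 + L} \<union> ({3*a/2, 3*a/2 + L} \<union> {2*a, 2*a + L} \<union> {5*a/2, 5*a/2 + L})) (\<lambda>t. r0 l t + c * r1 l t)"
    by (intro piecewise_cont_add piecewise_cont_r0 piecewise_cont_cmult piecewise_cont_r1)
  have sol: "sol a (q c) \<mu> x l = Y l c x" and dY: "dd 1 (Y l c) pi = free_sol' \<mu> l pi + duhamel' l (\<lambda>t. r0 l t + c * r1 l t) pi" for x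
    by (rule sol_duhamel[OF a_pos R _ \<mu> Y_def Y_delay], simp, blast)+
  have "char_fun \<nu> j a (q c) l = dd j (Y l c) pi"
    unfolding char_fun_def using assms(2) sol by (simp flip: assms(2))
  moreover have "Y l c pi = free_sol \<mu> l pi + duhamel l (r0 l) pi"
    by (simp add: Y_def duhamel_add_cmult[OF piecewise_cont_r0 piecewise_cont_r1] duhamel_r1)
  ultimately show ?thesis using assms(3) dY
    by (auto simp: dd_simps(1) duhamel_add_cmult[OF piecewise_cont_r0 piecewise_cont_r1] duhamel_r1)
qed


section \<open>Admissibility and distinctness of the potentials\<close>

lemma piecewise_cont_q: "\<exists>N. piecewise_cont N (q c)"
proof -
  have "piecewise_cont {5*a/2, 5*a/2 + L} (window (5*a/2) (5*a/2 + L) (\<lambda>x. h (x - 5*a/2)))"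
    by (intro piecewise_cont_window continuous_intros) auto
  moreover have "\<exists>N. piecewise_cont N e"
    unfolding e_def[abs_def] by (rule exI, rule piecewise_cont_add; rule piecewise_cont_window; intro continuous_intros; auto)
  ultimately show ?thesis unfolding q_def[abs_def] using piecewise_cont_add piecewise_cont_cmult by blast
qed

lemma is_potential_q: "is_potential a (q c)"
proof -
  obtain N where q: "piecewise_cont N (q c)" using piecewise_cont_q by blast
  then obtain M where M: "\<And>x. norm (q c x) \<le> M" unfolding piecewise_cont_def bounded_iff by auto
  have meas: "q c \<in> borel_measurable (lebesgue_on {0<..<pi})"
    using q unfolding piecewise_cont_def by (auto intro!: measurable_restrict_space1 measurable_completion)
  have "integrable (lebesgue_on {0<..<pi}) (\<lambda>x. (cmod (q c x))\<^sup>2)"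
  proof (rule finite_measure.integrable_const_bound[where B="M\<^sup>2"])
    show "finite_measure (lebesgue_on {0<..<pi})" by (intro finite_measure_lebesgue_on) simp
    show "AE x in lebesgue_on {0<..<pi}. norm ((cmod (q c x))\<^sup>2) \<le> M\<^sup>2"
      using M by (intro AE_I2) (simp add: power_mono)
    show "(\<lambda>x. (cmod (q c x))\<^sup>2) \<in> borel_measurable (lebesgue_on {0<..<pi})"
      using meas by measurable
  qed
  moreover have "AE x in lebesgue_on {0<..<a}. q c x = 0"
    using a_pos by (intro AE_I2) (auto simp: q_def e_def window_def)
  ultimately show ?thesis using meas unfolding is_potential_def in_L2_def by blast
qed

text \<open>The difference of the potentials is \<open>(c - d) * e\<close>, and just right of
  \<open>3*a/2\<close> the function \<open>e\<close> is a translate of \<open>f\<close> near 0,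
  hence nonzero on a whole interval.\<close>

lemma not_ae_eq_q:
  assumes f: "f 0 \<noteq> 0" and "c \<noteq> d"
  shows "\<not> ae_eq (q c) (q d)"
proof
  assume "ae_eq (q c) (q d)"
  then obtain N where N: "negligible N" "\<And>x. x \<in> {0<..<pi} - N \<Longrightarrow> q c x = q d x"
    unfolding ae_eq_def by (subst (asm) AE_lebesgue_on_negligible) auto
  have "isCont f 0" using cont(1) by (simp add: continuous_on_eq_continuous_at)
  then obtain \<delta> where \<delta>: "\<delta> > 0" "\<And>x. \<bar>x\<bar> < \<delta> \<Longrightarrow> f x \<noteq> 0"
    using continuous_at_avoid[where f = f and x = 0 and a = 0] f by (auto simp: dist_real_def)
  \<comment> \<open>The bound by \<open>L\<close> keeps the interval in the first window, left of
    the second one.\<close>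
  define r where "r = min \<delta> L"
  have "{3*a/2<..<3*a/2 + r} \<subseteq> N"
  proof
    fix x assume x: "x \<in> {3*a/2<..<3*a/2 + r}"
    have "f (x - 3*a/2) \<noteq> 0" by (rule \<delta>(2)) (use x in \<open>auto simp: r_def\<close>)
    then have "e x \<noteq> 0" using x L by (auto simp: e_def window_def r_def)
    then have "q c x \<noteq> q d x" using assms by (simp add: q_def)
    moreover have "r \<le> L" by (simp add: r_def)
    then have "x \<in> {0<..<pi}" using x L api a_pos by auto
    ultimately show "x \<in> N" using N(2)[of x] by blast
  qed
  then have "negligible (box (3*a/2) (3*a/2 + r))" using N(1) negligible_subset by simp
  then have "box (3*a/2) (3*a/2 + r) = {}" using negligible_interval(2) by blast
  then show False using \<delta>(1) L(1) by (simp add: r_def)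
qed

end

subsection \<open>An explicit choice of the profiles\<close>

text \<open>Wronskian of \<open>sin (m*(L-t))\<close> and \<open>sin (j*t)\<close>: its derivative
  is the product times the difference of the squared frequencies. The next lemma does the same for a
  cosine.\<close>

lemma deriv_sin_sin:
  fixes m j L t :: real
  shows "((\<lambda>t. m * cos (m*(L-t)) * sin (j*t) + j * sin (m*(L-t)) * cos (j*t))
    has_real_derivative (m*m - j*j) * (sin (m*(L-t)) * sin (j*t))) (at t within T)"
  by (rule derivative_eq_intros refl | simp add: algebra_simps)+

lemma deriv_sin_cos:
  fixes m j L x t :: real
  shows "((\<lambda>t. m * cos (m*(L-t)) * cos (j*(t-x)) - j * sin (m*(L-t)) * sin (j*(t-x)))
    has_real_derivative (m*m - j*j) * (sin (m*(L-t)) * cos (j*(t-x)))) (at t within T)"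
  by (rule derivative_eq_intros refl | simp add: algebra_simps)+

text \<open>As \<open>m*m\<close> is the mean of \<open>k*k\<close> and \<open>(2*k)*(2*k)\<close>,
  the factors \<open>m*m - j*j\<close> for \<open>j = k\<close> and \<open>j = 2*k\<close> are
  opposite. This compensates the opposite signs of \<open>cos (k*L)\<close> and
  \<open>cos (2*k*L)\<close>, so both modes have the same eigenvalue, and the remaining boundary
  terms of the two modes cancel.\<close>

lemma iso_bispectral_family_exists:
  assumes a: "0 < a" "a < pi/3" and \<mu>: "\<mu> \<in> {0,1}"
  shows "\<exists>L f F H h. iso_bispectral_family a L \<mu> f F H h \<and> f 0 \<noteq> 0"
proof -
  define s :: real where "s = (if \<mu> = 0 then 1 else -1)"
  \<comment> \<open>Satisfies \<open>L < a/2\<close> and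
    \<open>5*a/2 + L < 3*a < pi\<close>.\<close>
  define L where "L = a/4"
  define k where "k = pi/L"
  define m where "m = k * sqrt (5/2)"
  define f where "f x = cos (k*x) + cos (2*k*x)" for x
  define F where "F x = sin (k*x)/k + sin (2*k*x)/(2*k)" for x
  define H where "H x = s * (3*k\<^sup>2/(2*m)) * sin (m*(L - x))" for x
  define h where "h x = s * (3*k\<^sup>2/2) * cos (m*(L - x))" for x
  have L: "L > 0" and k: "k > 0" and m: "m > 0" using a by (auto simp: L_def k_def m_def)
  have m2: "m * m = 5/2 * k * k" by (simp add: m_def mult_ac)
  have diff1: "m*m - k*k = 3/2*k\<^sup>2" and diff2: "m*m - (2*k)*(2*k) = - (3/2*k\<^sup>2)"
    by (simp_all add: m2 power2_eq_square)
  have kL: "k * L = pi" "2 * k * L = 2 * pi" using L by (auto simp: k_def)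
  have sin0: "sin (k * L) = 0" "sin (2 * k * L) = 0" unfolding kL by simp_all
  have s: "s * s = 1" "bc_sign \<mu> = of_real s" by (auto simp: s_def bc_sign_def)
  have FH: "((\<lambda>x. F x * H x) has_integral 0) {0..L}"
  proof -
    \<comment> \<open>Antiderivative of \<open>F * H\<close>: the amplitude of \<open>H\<close>
      divided by \<open>m*m - j*j\<close> is \<open>s/m\<close> for \<open>j = k\<close> and
      \<open>- s/m\<close> for \<open>j = 2*k\<close>.\<close>
    define Q where "Q t = s/m * ((m * cos (m*(L-t)) * sin (k*t) + k * sin (m*(L-t)) * cos (k*t)) / k
       - (m * cos (m*(L-t)) * sin (2*k*t) + 2*k * sin (m*(L-t)) * cos (2*k*t)) / (2*k))" for t
    have "(Q has_real_derivative F t * H t) (at t within {0..L})" for t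
    proof -
      have "s/m * (3/2*k\<^sup>2 * (X * S) / k - (- (3/2*k\<^sup>2)) * (X * S') / (2*k))
         = (S/k + S'/(2*k)) * (s * (3*k\<^sup>2/(2*m)) * X)" for X S S' :: real
        using k m by (simp add: field_simps)
      then show ?thesis
        using DERIV_cmult[OF DERIV_diff[OF DERIV_cdivide[OF deriv_sin_sin[of m L k t], where c = k]
              DERIV_cdivide[OF deriv_sin_sin[of m L "2*k" t], where c = "2*k"]], where c = "s/m" and s = "{0..L}"]
        unfolding Q_def[abs_def] F_def H_def diff1 diff2 by simp
    qed
    then have "((\<lambda>x. F x * H x) has_integral Q L - Q 0) {0..L}"
      using L by (intro fundamental_theorem_of_calculus) (auto simp: has_real_derivative_iff_has_vector_derivative[symmetric])
    \<comment> \<open>At 0 each mode leaves a term \<open>sin (m*L)\<close>, and these have opposite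
      signs; this is what the second mode achieves.\<close>
    moreover have "Q L = 0" "Q 0 = 0" using sin0 k by (auto simp: Q_def)
    ultimately show ?thesis by simp
  qed
  have eig: "((\<lambda>t. H t * f (t - x)) has_integral - s * f x) {x..L}" if x: "x \<in> {0..L}" for x
  proof -
    define Q where "Q t = s/m * ((m * cos (m*(L-t)) * cos (k*(t-x)) - k * sin (m*(L-t)) * sin (k*(t-x)))
       - (m * cos (m*(L-t)) * cos (2*k*(t-x)) - 2*k * sin (m*(L-t)) * sin (2*k*(t-x))))" for t
    have "(Q has_real_derivative H t * f (t - x)) (at t within {x..L})" for t
    proof -
      have "s/m * (3/2*k\<^sup>2 * (X * S) - (- (3/2*k\<^sup>2)) * (X * S'))
         = s * (3*k\<^sup>2/(2*m)) * X * (S + S')" for X S S' :: real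
        using m by (simp add: field_simps)
      then show ?thesis
        using DERIV_cmult[OF DERIV_diff[OF deriv_sin_cos[of m L k x t] deriv_sin_cos[of m L "2*k" x t]], where c = "s/m" and s = "{x..L}"]
        unfolding Q_def[abs_def] f_def H_def diff1 diff2 by simp
    qed
    then have "((\<lambda>t. H t * f (t - x)) has_integral Q L - Q x) {x..L}"
      using x by (intro fundamental_theorem_of_calculus) (auto simp: has_real_derivative_iff_has_vector_derivative[symmetric])
    moreover have "Q x = 0" by (simp add: Q_def)
    moreover have "Q L = - s * f x"
    proof -
      \<comment> \<open>Reflection at \<open>L\<close> changes the sign of the first cosine and
        keeps the second, which turns the difference in \<open>Q\<close> into a multiple of the sum
        \<open>f\<close>.\<close>
      have "k * (L - x) = pi - k * x" "2 * k * (L - x) = 2 * pi - 2 * k * x"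
        using kL by (simp_all add: right_diff_distrib)
      then have "cos (k*(L-x)) = - cos (k*x)" "cos (2*k*(L-x)) = cos (2*k*x)"
        by (simp_all only: cos_pi_minus cos_2pi_minus)
      then have "Q L = s/m * (m * (- cos (k*x)) - m * cos (2*k*x))" by (simp add: Q_def)
      also have "\<dots> = - s * f x" using m by (simp add: f_def field_simps)
      finally show ?thesis .
    qed
    ultimately show ?thesis by simp
  qed
  have "iso_bispectral_family a L \<mu> (\<lambda>x. of_real (f x)) (\<lambda>x. of_real (F x)) (\<lambda>x. of_real (H x)) (\<lambda>x. of_real (h x))"
  proof
    show "0 < L" "L < a/2" "5*a/2 + L < pi" "\<mu> \<in> {0,1}" using a \<mu> by (auto simp: L_def)
    show "continuous_on UNIV (\<lambda>x. complex_of_real (f x))" "continuous_on UNIV (\<lambda>x. complex_of_real (h x))"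
      unfolding f_def h_def by (intro continuous_intros)+
    have "(F has_real_derivative cos (k*x) * k / k + cos (2*k*x) * (2*k) / (2*k)) (at x)" for x
      unfolding F_def[abs_def]
      by (intro DERIV_add DERIV_cdivide DERIV_fun_sin DERIV_cmult_Id)
    then have "(F has_real_derivative f x) (at x)" for x using k by (simp add: f_def)
    then show "((\<lambda>x. complex_of_real (F x)) has_vector_derivative of_real (f x)) (at x)" for x
      by (rule has_vector_derivative_of_real)
    have "((\<lambda>x. m * (L - x)) has_real_derivative m * (0 - 1)) (at x)" for x
      by (intro DERIV_cmult DERIV_diff DERIV_const DERIV_ident)
    from DERIV_cmult[OF DERIV_fun_sin[OF this]]
    have Hd: "(H has_real_derivative s * (3*k\<^sup>2/(2*m)) * (cos (m*(L - x)) * (m * (0 - 1)))) (at x)" for x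
      unfolding H_def[abs_def] .
    have Hh: "s * (3*k\<^sup>2/(2*m)) * (cos (m*(L - x)) * (m * (0 - 1))) = - h x" for x
      using m by (simp add: h_def field_simps)
    have "(H has_real_derivative - h x) (at x)" for x
      using Hd[of x] unfolding Hh .
    from has_vector_derivative_of_real[OF this] 
    show "((\<lambda>x. complex_of_real (H x)) has_vector_derivative - of_real (h x)) (at x)" for x by simp
    show "complex_of_real (F 0) = 0" "complex_of_real (F L) = 0" "complex_of_real (H L) = 0"
      using sin0 by (simp_all add: F_def H_def)
    show "integral {0..L} (\<lambda>x. complex_of_real (F x) * complex_of_real (H x)) = 0"
      using has_integral_of_real[OF FH, where 'b = complex] by (simp add: integral_unique)
    show "bc_sign \<mu> * integral {x..L} (\<lambda>t. complex_of_real (H t) * complex_of_real (f (t - x))) = - complex_of_real (f x)"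
      if "x \<in> {0..L}" for x
    proof -
      have "integral {x..L} (\<lambda>t. complex_of_real (H t) * complex_of_real (f (t - x))) = of_real (- s * f x)"
        using has_integral_of_real[OF eig[OF that], where 'b = complex] by (simp add: integral_unique)
      then have "bc_sign \<mu> * integral {x..L} (\<lambda>t. complex_of_real (H t) * complex_of_real (f (t - x))) = of_real (- (s * s) * f x)"
        by (simp add: s(2))
      then show ?thesis by (simp add: s(1))
    qed
  qed
  moreover have "complex_of_real (f 0) \<noteq> 0" by (simp add: f_def)
  ultimately show ?thesis by (intro exI conjI)
qed

theorem mainTheorem1:
  fixes a :: real and \<nu> :: nat
  assumes "a \<in> {0<..<pi/3}" and "\<nu> \<in> {0,1}"
  shows "\<exists>B :: (real \<Rightarrow> complex) set.
    infinite B \<and>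
    (\<forall>q\<in>B. is_potential a q) \<and>
    (\<forall>p\<in>B. \<forall>q\<in>B. p \<noteq> q \<longrightarrow> \<not> ae_eq p q) \<and>
    (\<forall>j\<in>{0,1}. \<forall>p\<in>B. \<forall>q\<in>B. spectrum \<nu> j a p = spectrum \<nu> j a q)"
proof -
  define \<mu> where "\<mu> = 1 - \<nu>"
  have \<mu>: "\<mu> \<in> {0,1}" using assms(2) by (auto simp: \<mu>_def)
  obtain L f F H h where "iso_bispectral_family a L \<mu> f F H h" and f0: "f 0 \<noteq> 0"
    using iso_bispectral_family_exists[OF _ _ \<mu>] assms(1) by (metis greaterThanLessThan_iff)
  then interpret iso_bispectral_family a L \<mu> f F H h by simp
  note ne = not_ae_eq_q[OF f0]
  have "inj q"
  proof (rule injI, rule ccontr)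
    fix c d assume "q c = q d" "c \<noteq> d"
    then show False using ne[of c d] by (simp add: ae_eq_def)
  qed
  then have inf: "infinite (range q)" by (metis finite_imageD infinite_UNIV_char_0)
  \<comment> \<open>The characteristic functions agree as functions of \<open>l\<close>, so the
    orders of their zeros agree as well.\<close>
  have char: "char_fun \<nu> j a (q c) = char_fun \<nu> j a (q d)" if "j \<in> {0,1}" for j c d
    using char_fun_q[OF assms(2) \<mu>_def that] by (intro ext) simp
  have spec: "spectrum \<nu> j a (q c) = spectrum \<nu> j a (q d)" if "j \<in> {0,1}" for j c d
    unfolding spectrum_def char[OF that, of c d] ..
  show ?thesis
  proof (intro exI[of _ "range q"] conjI ballI impI inf)
    show "is_potential a p" if "p \<in> range q" for p
      using that is_potential_q by auto
    show "\<not> ae_eq p r" if "p \<in> range q" "r \<in> range q" "p \<noteq> r" for p r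
    proof -
      from that obtain c d where "p = q c" "r = q d" "c \<noteq> d" by auto
      then show ?thesis using ne by simp
    qed
    show "spectrum \<nu> j a p = spectrum \<nu> j a r" if "j \<in> {0,1}" "p \<in> range q" "r \<in> range q" for j p r
      using that(2,3) spec[OF that(1)] by auto
  qed
qed

end
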